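(* Let $\mathcal M$ be a Riemannian manifold, let $\mathcal C\subset\mathcal M$ be strongly convex, let $F\colon\mathcal C\to\overline{\mathbb R}$ be proper and let $m\in\mathcal C$. Then $$F(p)+F_m^*(\xi_m)\ \ge\ \langle \xi_m,\log_m p\rangle$$ holds for all $p\in\mathcal C$ and all $\xi_m\in T_m^*\mathcal M$.
   Context: $\mathcal M$ is a connected, finite-dimensional smooth Riemannian manifold with tangent spaces $T_p\mathcal M$, cotangent spaces $T_p^*\mathcal M$, duality pairing $\langle\cdot,\cdot\rangle$ between $T_p^*\mathcal M$ and $T_p\mathcal M$, norm $\|\cdot\|_p$ induced by the metric, Riemannian distance $d$ and exponential map $\exp_p$. $\overline{\mathbb R}=\mathbb R\cup\{\pm\infty\}$. A set $\mathcal C\subset\mathcal M$ is strongly convex if for any $p,q\in\mathcal C$ there is a unique shortest geodesic of $\mathcal M$ connecting $p$ to $q$, and that geodesic lies completely in $\mathcal C$. For $m\in\mathcal C$ let $\mathcal L_{\mathcal C,m}=\{X\in T_m\mathcal M:\exp_m X\in\mathcal C \text{ and } \|X\|_m=d(\exp_m X,m)\}$. If $\mathcal C$ is strongly convex, $\exp_m\colon\mathcal L_{\mathcal C,m}\to\mathcal C$ is a bijection, and $\log_m\colon\mathcal C\to\mathcal L_{\mathcal C,m}$ denotes its inverse. A function is proper if it is not identically $+\infty$ and never takes the value $-\infty$. The $m$-Fenchel conjugate of $F\colon\mathcal C\to\overline{\mathbb R}$ is $F_m^*\colon T_m^*\mathcal M\to\overline{\mathbb R}$, $F_m^*(\xi_m)=\sup_{X\in\mathcal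 L_{\mathcal C,m}}\{\langle\xi_m,X\rangle-F(\exp_m X)\}$. *)

theory Defs
  imports "HOL-Analysis.Analysis"
begin

text \<open>
  On an open subset of a finite-dimensional space, being \<open>C\<^sup>k\<^sup>+\<^sup>1\<close> means being differentiable with
  all directional derivatives \<open>x \<mapsto> Df(x)v\<close> of class \<open>C\<^sup>k\<close>.
  The predicates are only used for open \<open>S\<close>.
\<close>

primrec Ck_on :: "nat \<Rightarrow> 'a::real_normed_vector set \<Rightarrow> ('a \<Rightarrow> 'b::real_normed_vector) \<Rightarrow> bool" where
  "Ck_on 0 S f \<longleftrightarrow> continuous_on S f"
| "Ck_on (Suc k) S f \<longleftrightarrow>
     (\<forall>x\<in>S. f differentiable (at x)) \<and> (\<forall>v. Ck_on k S (\<lambda>x. frechet_derivative f (at x) v))"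

definition smooth_on :: "'a::real_normed_vector set \<Rightarrow> ('a \<Rightarrow> 'b::real_normed_vector) \<Rightarrow> bool" where
  "smooth_on S f \<longleftrightarrow> (\<forall>k. Ck_on k S f)"

text \<open>
  The manifold is the whole type \<open>'m\<close>.  A chart \<open>(U, \<phi>)\<close> consists of its domain \<open>U\<close> and a
  coordinate map \<open>\<phi>\<close>, whose values outside \<open>U\<close> are irrelevant.  A tangent vector at \<open>p\<close> is the
  family of its coordinate representations in all charts around \<open>p\<close>, these being related by the
  Jacobians of the chart transitions; at all other charts the family is \<open>0\<close>, so that vector
  space operations are pointwise.
\<close>

type_synonym ('m, 'e) chart = "'m set \<times> ('m \<Rightarrow> 'e)"
type_synonym ('m, 'e) tvec = "('m, 'e) chart \<Rightarrow> 'e"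

record ('m, 'e) riemannian_structure =
  atlas :: "('m, 'e) chart set"
  metric :: "'m \<Rightarrow> ('m, 'e) tvec \<Rightarrow> ('m, 'e) tvec \<Rightarrow> real"

definition chart_inv :: "('m, 'e) chart \<Rightarrow> 'e \<Rightarrow> 'm" where
  "chart_inv c = inv_into (fst c) (snd c)"

definition transition ::
    "('m, 'e) chart \<Rightarrow> ('m, 'e) chart \<Rightarrow> 'e \<Rightarrow> 'e" where
  "transition c c' = snd c' \<circ> chart_inv c"

definition tangent_space ::
    "('m, 'e::real_normed_vector, 'z) riemannian_structure_scheme \<Rightarrow> 'm \<Rightarrow> ('m, 'e) tvec set" where
  "tangent_space M p =
     {X. (\<forall>c. c \<notin> atlas M \<or> p \<notin> fst c \<longrightarrow> X c = 0) \<and>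
         (\<forall>c\<in>atlas M. \<forall>c'\<in>atlas M. p \<in> fst c \<inter> fst c' \<longrightarrow>
            X c' = frechet_derivative (transition c c') (at (snd c p)) (X c))}"

definition cotangent_space ::
    "('m, 'e::real_normed_vector, 'z) riemannian_structure_scheme \<Rightarrow> 'm \<Rightarrow> (('m, 'e) tvec \<Rightarrow> real) set" where
  "cotangent_space M p =
     {\<xi> \<in> extensional (tangent_space M p).
        \<forall>X\<in>tangent_space M p. \<forall>Y\<in>tangent_space M p. \<forall>a b.
          \<xi> (\<lambda>c. a *\<^sub>R X c + b *\<^sub>R Y c) = a * \<xi> X + b * \<xi> Y}"

text \<open>The tangent vector at \<open>p\<close> whose representation in the chart \<open>c\<close> is \<open>v\<close>.\<close>

definition coord_vec ::
    "('m, 'e::real_normed_vector, 'z) riemannian_structure_scheme \<Rightarrow> ('m, 'e) chart \<Rightarrow> 'm \<Rightarrow> 'e \<Rightarrow> ('m, 'e) tvec" where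
  "coord_vec M c p v =
     (\<lambda>c'. if c' \<in> atlas M \<and> p \<in> fst c'
           then frechet_derivative (transition c c') (at (snd c p)) v else 0)"

definition chart_metric ::
    "('m, 'e::real_normed_vector, 'z) riemannian_structure_scheme \<Rightarrow> ('m, 'e) chart \<Rightarrow> 'e \<Rightarrow> 'e \<Rightarrow> 'e \<Rightarrow> real" where
  "chart_metric M c x u v =
     metric M (chart_inv c x) (coord_vec M c (chart_inv c x) u) (coord_vec M c (chart_inv c x) v)"

text \<open>
  The model space is an arbitrary finite-dimensional inner product space, rather than one of class
  \<^class>\<open>euclidean_space\<close>, so as to admit dimension \<open>0\<close>.
\<close>

locale riemannian_manifold =
  fixes M :: "('m::{t2_space, second_countable_topology}, 'e::real_inner) riemannian_structure"
  assumes connected_manifold: "connected (UNIV :: 'm set)"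
    and finite_dimensional: "\<exists>B :: 'e set. finite B \<and> span B = UNIV"
    and charts_cover: "(\<Union>c\<in>atlas M. fst c) = UNIV"
    and chart_domain_open: "c \<in> atlas M \<Longrightarrow> open (fst c)"
    and chart_image_open: "c \<in> atlas M \<Longrightarrow> open (snd c ` fst c)"
    and chart_homeomorphism:
      "c \<in> atlas M \<Longrightarrow> homeomorphism (fst c) (snd c ` fst c) (snd c) (chart_inv c)"
    and transition_smooth:
      "c \<in> atlas M \<Longrightarrow> c' \<in> atlas M \<Longrightarrow> smooth_on (snd c ` (fst c \<inter> fst c')) (transition c c')"
    and metric_sym:
      "X \<in> tangent_space M p \<Longrightarrow> Y \<in> tangent_space M p \<Longrightarrow> metric M p X Y = metric M p Y X"
    and metric_linear:
      "X \<in> tangent_space M p \<Longrightarrow> Y \<in> tangent_space M p \<Longrightarrow> Z \<in> tangent_space M p \<Longrightarrow>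
       metric M p (\<lambda>c. a *\<^sub>R X c + b *\<^sub>R Y c) Z = a * metric M p X Z + b * metric M p Y Z"
    and metric_pos:
      "X \<in> tangent_space M p \<Longrightarrow> X \<noteq> (\<lambda>c. 0) \<Longrightarrow> metric M p X X > 0"
    and metric_smooth:
      "c \<in> atlas M \<Longrightarrow> smooth_on (snd c ` fst c) (\<lambda>x. chart_metric M c x u v)"

definition tnorm ::
    "('m, 'e::real_normed_vector, 'z) riemannian_structure_scheme \<Rightarrow> 'm \<Rightarrow> ('m, 'e) tvec \<Rightarrow> real" where
  "tnorm M p X = sqrt (metric M p X X)"

definition velocity ::
    "('m, 'e::real_normed_vector, 'z) riemannian_structure_scheme \<Rightarrow> (real \<Rightarrow> 'm) \<Rightarrow> real \<Rightarrow> ('m, 'e) tvec" where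
  "velocity M \<gamma> t =
     (\<lambda>c. if c \<in> atlas M \<and> \<gamma> t \<in> fst c then vector_derivative (snd c \<circ> \<gamma>) (at t) else 0)"

text \<open>Only used for open \<open>J\<close>.\<close>

definition smooth_curve_on ::
    "('m::topological_space, 'e::real_normed_vector, 'z) riemannian_structure_scheme \<Rightarrow> real set \<Rightarrow> (real \<Rightarrow> 'm) \<Rightarrow> bool" where
  "smooth_curve_on M J \<gamma> \<longleftrightarrow>
     continuous_on J \<gamma> \<and> (\<forall>c\<in>atlas M. smooth_on {t \<in> J. \<gamma> t \<in> fst c} (snd c \<circ> \<gamma>))"

text \<open>
  \<open>S\<close> is the set of break points: on the closed interval between two consecutive ones, the curve
  agrees with a curve that is smooth on an open neighbourhood of that interval.
\<close>

definition piecewise_smooth_curve ::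
    "('m::topological_space, 'e::real_normed_vector, 'z) riemannian_structure_scheme \<Rightarrow> (real \<Rightarrow> 'm) \<Rightarrow> bool" where
  "piecewise_smooth_curve M \<gamma> \<longleftrightarrow>
     continuous_on {0..1} \<gamma> \<and>
     (\<exists>S. finite S \<and> {0, 1} \<subseteq> S \<and> S \<subseteq> {0..1} \<and>
        (\<forall>a\<in>S. \<forall>b\<in>S. a < b \<and> {a<..<b} \<inter> S = {} \<longrightarrow>
           (\<exists>J \<eta>. open J \<and> {a..b} \<subseteq> J \<and> smooth_curve_on M J \<eta> \<and> (\<forall>t\<in>{a..b}. \<eta> t = \<gamma> t))))"

text \<open>
  The velocity is meaningless at the finitely many break points and at the end points, which does
  not affect the integral.
\<close>

definition curve_length ::
    "('m, 'e::real_normed_vector, 'z) riemannian_structure_scheme \<Rightarrow> (real \<Rightarrow> 'm) \<Rightarrow> real" where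
  "curve_length M \<gamma> = integral {0..1} (\<lambda>t. tnorm M (\<gamma> t) (velocity M \<gamma> t))"

definition rdist ::
    "('m::topological_space, 'e::real_normed_vector, 'z) riemannian_structure_scheme \<Rightarrow> 'm \<Rightarrow> 'm \<Rightarrow> real" where
  "rdist M p q = Inf {curve_length M \<gamma> |\<gamma>. piecewise_smooth_curve M \<gamma> \<and> \<gamma> 0 = p \<and> \<gamma> 1 = q}"

text \<open>
  The Christoffel symbols of the first kind,
  \<open>\<Gamma>(u, v; w) = (D\<^sub>u g(v, w) + D\<^sub>v g(u, w) - D\<^sub>w g(u, v)) / 2\<close>, at the coordinates \<open>x\<close>.
\<close>

definition christoffel ::
    "('m, 'e::real_normed_vector, 'z) riemannian_structure_scheme \<Rightarrow> ('m, 'e) chart \<Rightarrow> 'e \<Rightarrow> 'e \<Rightarrow> 'e \<Rightarrow> 'e \<Rightarrow> real" where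
  "christoffel M c x u v w =
     (frechet_derivative (\<lambda>y. chart_metric M c y v w) (at x) u
      + frechet_derivative (\<lambda>y. chart_metric M c y u w) (at x) v
      - frechet_derivative (\<lambda>y. chart_metric M c y u v) (at x) w) / 2"

text \<open>
  The geodesic equation \<open>\<nabla>\<^bsub>\<gamma>'\<^esub> \<gamma>' = 0\<close> for the Levi-Civita connection in local coordinates,
  with the index lowered by the (nondegenerate) metric:
  \<open>g(\<sigma>'', w) + \<Gamma>(\<sigma>', \<sigma>'; w) = 0\<close> for all \<open>w\<close>, where \<open>\<sigma>\<close> is the coordinate representation of \<open>\<gamma>\<close>.
\<close>

definition geodesic_on ::
    "('m::topological_space, 'e::real_normed_vector, 'z) riemannian_structure_scheme \<Rightarrow> real set \<Rightarrow> (real \<Rightarrow> 'm) \<Rightarrow> bool" where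
  "geodesic_on M J \<gamma> \<longleftrightarrow>
     smooth_curve_on M J \<gamma> \<and>
     (\<forall>c\<in>atlas M. \<forall>t\<in>J. \<gamma> t \<in> fst c \<longrightarrow>
        (let \<sigma> = snd c \<circ> \<gamma>;
             \<sigma>' = (\<lambda>s. vector_derivative \<sigma> (at s));
             \<sigma>'' = (\<lambda>s. vector_derivative \<sigma>' (at s))
         in \<forall>w. chart_metric M c (\<sigma> t) (\<sigma>'' t) w + christoffel M c (\<sigma> t) (\<sigma>' t) (\<sigma>' t) w = 0))"

text \<open>Geodesics are defined on a neighbourhood of \<open>{0..1}\<close> so that they have a velocity at \<open>0\<close>.\<close>

definition geodesic_between ::
    "('m::topological_space, 'e::real_normed_vector, 'z) riemannian_structure_scheme \<Rightarrow> 'm \<Rightarrow> 'm \<Rightarrow> (real \<Rightarrow> 'm) \<Rightarrow> bool" where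
  "geodesic_between M p q \<gamma> \<longleftrightarrow>
     (\<exists>J. open J \<and> {0..1} \<subseteq> J \<and> geodesic_on M J \<gamma>) \<and> \<gamma> 0 = p \<and> \<gamma> 1 = q"

definition shortest_geodesic ::
    "('m::topological_space, 'e::real_normed_vector, 'z) riemannian_structure_scheme \<Rightarrow> 'm \<Rightarrow> 'm \<Rightarrow> (real \<Rightarrow> 'm) \<Rightarrow> bool" where
  "shortest_geodesic M p q \<gamma> \<longleftrightarrow> geodesic_between M p q \<gamma> \<and> curve_length M \<gamma> = rdist M p q"

text \<open>Uniqueness concerns the geodesic parametrised over \<open>{0..1}\<close>, not its values elsewhere.\<close>

definition strongly_convex ::
    "('m::topological_space, 'e::real_normed_vector, 'z) riemannian_structure_scheme \<Rightarrow> 'm set \<Rightarrow> bool" where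
  "strongly_convex M C \<longleftrightarrow>
     (\<forall>p\<in>C. \<forall>q\<in>C. \<exists>\<gamma>. shortest_geodesic M p q \<gamma> \<and>
        (\<forall>\<eta>. shortest_geodesic M p q \<eta> \<longrightarrow> (\<forall>t\<in>{0..1}. \<eta> t = \<gamma> t)) \<and>
        \<gamma> ` {0..1} \<subseteq> C)"

text \<open>
  No completeness is assumed, so the exponential map at \<open>p\<close> is only defined on the set of those
  \<open>X\<close> for which the geodesic with initial velocity \<open>X\<close> exists up to time \<open>1\<close>.
\<close>

definition exp_domain ::
    "('m::topological_space, 'e::real_normed_vector, 'z) riemannian_structure_scheme \<Rightarrow> 'm \<Rightarrow> ('m, 'e) tvec set" where
  "exp_domain M p =
     {X \<in> tangent_space M p. \<exists>q \<gamma>. geodesic_between M p q \<gamma> \<and> velocity M \<gamma> 0 = X}"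

definition exp_map ::
    "('m::topological_space, 'e::real_normed_vector, 'z) riemannian_structure_scheme \<Rightarrow> 'm \<Rightarrow> ('m, 'e) tvec \<Rightarrow> 'm" where
  "exp_map M p X = (THE q. \<exists>\<gamma>. geodesic_between M p q \<gamma> \<and> velocity M \<gamma> 0 = X)"

definition log_domain ::
    "('m::topological_space, 'e::real_normed_vector, 'z) riemannian_structure_scheme \<Rightarrow> 'm set \<Rightarrow> 'm \<Rightarrow> ('m, 'e) tvec set" where
  "log_domain M C m =
     {X \<in> exp_domain M m. exp_map M m X \<in> C \<and> tnorm M m X = rdist M (exp_map M m X) m}"

definition log_map ::
    "('m::topological_space, 'e::real_normed_vector, 'z) riemannian_structure_scheme \<Rightarrow> 'm set \<Rightarrow> 'm \<Rightarrow> 'm \<Rightarrow> ('m, 'e) tvec" where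
  "log_map M C m = inv_into (log_domain M C m) (exp_map M m)"

text \<open>Functions on \<open>C\<close> are total functions of which only the values on \<open>C\<close> are used.\<close>

definition proper_on :: "'m set \<Rightarrow> ('m \<Rightarrow> ereal) \<Rightarrow> bool" where
  "proper_on C F \<longleftrightarrow> (\<exists>p\<in>C. F p \<noteq> \<infinity>) \<and> (\<forall>p\<in>C. F p \<noteq> -\<infinity>)"

definition fenchel_conjugate ::
    "('m::topological_space, 'e::real_normed_vector, 'z) riemannian_structure_scheme \<Rightarrow> 'm set \<Rightarrow> 'm \<Rightarrow>
     ('m \<Rightarrow> ereal) \<Rightarrow> (('m, 'e) tvec \<Rightarrow> real) \<Rightarrow> ereal" where
  "fenchel_conjugate M C m F \<xi> = (SUP X\<in>log_domain M C m. ereal (\<xi> X) - F (exp_map M m X))"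

end

theory Submission
  imports Defs
begin

text \<open>
  The inequality is the definition of a supremum: if \<open>X = log\<^sub>m p\<close> lies in the domain of the logarithm
  and \<open>exp\<^sub>m X = p\<close>, then \<open>\<xi> X - F p\<close> is one of the values whose supremum is \<open>F\<^sub>m\<^sup>* \<xi>\<close>, and
  \<open>F p \<noteq> -\<infinity>\<close> allows \<open>F p\<close> to be moved to the other side.  Since the logarithm is an inverse
  function taken on a range, the two facts about \<open>X\<close> hold as soon as \<open>exp\<^sub>m\<close> maps its restricted
  domain onto \<open>C\<close> (\<open>exp_map_surj_on_log_domain\<close>).  This surjectivity is where the geometry lies.

  Strong convexity provides a shortest geodesic \<open>\<gamma>\<close> from \<open>m\<close> to \<open>p\<close>, and the preimage of \<open>p\<close> is its
  initial velocity \<open>X\<close>.  Four facts make this work.  By the chain rule for chart transitions, \<open>X\<close> is a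
  tangent vector (\<open>velocity_tangent\<close>).  A geodesic is determined by its initial point and velocity, so
  that \<open>exp\<^sub>m X\<close>, a definite description, really is \<open>\<gamma> 1 = p\<close> (\<open>geodesic_uniqueness\<close>).  A geodesic has
  constant speed, so its length, which is \<open>d(m, p)\<close>, equals the norm of \<open>X\<close> (\<open>geodesic_length\<close>).
  Finally the domain of the logarithm is described by \<open>d(p, m)\<close>, whence the need for the symmetry of
  the distance, which comes from running curves backwards (\<open>rdist_commute\<close>).

  Uniqueness of geodesics is the longest part.  In a chart two geodesics solve the same second-order
  equation, whose acceleration is given implicitly by the metric.  Near a point the metric is
  uniformly positive definite and its coefficients and the Christoffel symbols are Lipschitz, so the
  difference of the accelerations is bounded by a multiple of the differences of position and
  velocity (\<open>implicit_quadratic_equation_lipschitz\<close>); a Gronwall argument then gives local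
  uniqueness, and connectedness of the unit interval makes it global.  An orthonormal frame of the
  model space reduces multilinear estimates to finitely many scalar coefficients.
\<close>

section \<open>Orthonormal frames\<close>

definition orthonormal_frame :: "'e::real_inner set \<Rightarrow> bool" where
  "orthonormal_frame B \<longleftrightarrow>
     finite B \<and> (\<forall>b\<in>B. norm b = 1) \<and> (\<forall>v. (\<Sum>b\<in>B. (v \<bullet> b) *\<^sub>R b) = v)"

text \<open>
  Gram--Schmidt yields an orthogonal spanning set; its nonzero members are normalised.  In dimension
  \<open>0\<close> the frame is empty.
\<close>

lemma orthonormal_frame_exists:
  assumes "finite (A :: 'e::real_inner set)" "span A = UNIV"
  shows "\<exists>B :: 'e set. orthonormal_frame B"
proof -
  obtain C where C: "finite C" "span C = (UNIV :: 'e set)" "pairwise orthogonal C"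
    using basis_orthogonal[OF assms(1)] unfolding assms(2) by blast
  define D where "D = C - {0}"
  define B where "B = (\<lambda>c. c /\<^sub>R norm c) ` D"
  have D: "finite D" "span D = UNIV" "\<And>c. c \<in> D \<Longrightarrow> c \<noteq> 0" "pairwise orthogonal D"
    using C(1,2) pairwise_mono[OF C(3)] span_delete_0[of C] by (simp_all add: D_def)
  have B: "finite B" "\<And>b. b \<in> B \<Longrightarrow> norm b = 1"
    using D by (auto simp: B_def)
  have orth: "b \<bullet> b' = (if b = b' then 1 else 0)" if bb': "b \<in> B" "b' \<in> B" for b b'
  proof (cases "b = b'")
    case True
    then show ?thesis using B(2)[OF bb'(1)] by (simp add: dot_square_norm power2_eq_square)
  next
    case False
    obtain c c' where "c \<in> D" "c' \<in> D" "b = c /\<^sub>R norm c" "b' = c' /\<^sub>R norm c'"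
      using bb' by (auto simp: B_def)
    moreover from this False have "c \<bullet> c' = 0"
      using D(4) by (auto simp: pairwise_def orthogonal_def)
    ultimately show ?thesis using False by simp
  qed
  have "D \<subseteq> span B"
  proof
    fix c assume c: "c \<in> D"
    then have "norm c *\<^sub>R (c /\<^sub>R norm c) \<in> span B"
      by (intro span_scale span_base) (auto simp: B_def)
    then show "c \<in> span B" using D(3)[OF c] by simp
  qed
  then have "span B = UNIV"
    using D(2) span_minimal[OF _ subspace_span, of D B] by (simp add: top.extremum_unique)
  then have range: "range (\<lambda>u. \<Sum>b\<in>B. u b *\<^sub>R b) = UNIV"
    using span_finite[OF B(1)] by simp
  have "(\<Sum>b\<in>B. (v \<bullet> b) *\<^sub>R b) = v" for v
  proof -
    have "v \<in> range (\<lambda>u. \<Sum>b\<in>B. u b *\<^sub>R b)" unfolding range by (rule UNIV_I)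
    then obtain u where u: "v = (\<Sum>b\<in>B. u b *\<^sub>R b)" by (rule imageE)
    have coeff: "v \<bullet> b = u b" if "b \<in> B" for b
    proof -
      have "v \<bullet> b = (\<Sum>b'\<in>B. if b' = b then u b' else 0)"
        unfolding u inner_sum_left by (rule sum.cong) (auto simp: orth that)
      then show ?thesis using that B(1) by simp
    qed
    have "(\<Sum>b\<in>B. (v \<bullet> b) *\<^sub>R b) = (\<Sum>b\<in>B. u b *\<^sub>R b)"
      by (rule sum.cong) (simp_all add: coeff)
    then show ?thesis unfolding u[symmetric] .
  qed
  then have "orthonormal_frame B" unfolding orthonormal_frame_def using B by blast
  then show ?thesis ..
qed

lemma frame_inner_le_norm:
  assumes "orthonormal_frame B" "b \<in> B"
  shows "\<bar>v \<bullet> b\<bar> \<le> norm v"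
  using Cauchy_Schwarz_ineq2[of v b] assms by (simp add: orthonormal_frame_def)

lemma linear_frame_expansion:
  assumes "orthonormal_frame B" "linear f"
  shows "f u = (\<Sum>b\<in>B. (u \<bullet> b) *\<^sub>R f b)"
proof -
  have "f u = f (\<Sum>b\<in>B. (u \<bullet> b) *\<^sub>R b)"
    using assms(1) by (simp add: orthonormal_frame_def)
  then show ?thesis
    by (simp add: linear_sum[OF assms(2)] linear_cmul[OF assms(2)])
qed

lemma bilinear_frame_expansion:
  fixes g :: "'e::real_inner \<Rightarrow> 'e \<Rightarrow> real"
  assumes "orthonormal_frame B" "\<And>v. linear (\<lambda>u. g u v)" "\<And>u. linear (g u)"
  shows "g u v = (\<Sum>(i, j)\<in>B \<times> B. ((u \<bullet> i) * (v \<bullet> j)) * g i j)"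
proof -
  have "g u v = (\<Sum>i\<in>B. (u \<bullet> i) * g i v)"
    using linear_frame_expansion[OF assms(1,2), of u v] by simp
  also have "\<dots> = (\<Sum>i\<in>B. \<Sum>j\<in>B. ((u \<bullet> i) * (v \<bullet> j)) * g i j)"
  proof (rule sum.cong[OF refl])
    fix i
    have "g i v = (\<Sum>j\<in>B. (v \<bullet> j) * g i j)"
      using linear_frame_expansion[OF assms(1,3), of i v] by simp
    then show "(u \<bullet> i) * g i v = (\<Sum>j\<in>B. ((u \<bullet> i) * (v \<bullet> j)) * g i j)"
      by (simp add: sum_distrib_left mult.assoc)
  qed
  finally show ?thesis by (simp add: sum.cartesian_product)
qed

lemma trilinear_frame_expansion:
  fixes g :: "'e::real_inner \<Rightarrow> 'e \<Rightarrow> 'e \<Rightarrow> real"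
  assumes "orthonormal_frame B" "\<And>v w. linear (\<lambda>u. g u v w)" "\<And>u w. linear (\<lambda>v. g u v w)"
    "\<And>u v. linear (g u v)"
  shows "g u v w = (\<Sum>(k, i, j)\<in>B \<times> B \<times> B. ((u \<bullet> k) * ((v \<bullet> i) * (w \<bullet> j))) * g k i j)"
proof -
  have "g u v w = (\<Sum>k\<in>B. (u \<bullet> k) * g k v w)"
    using linear_frame_expansion[OF assms(1,2), of u v w] by simp
  also have "\<dots> = (\<Sum>k\<in>B. \<Sum>(i, j)\<in>B \<times> B. ((u \<bullet> k) * ((v \<bullet> i) * (w \<bullet> j))) * g k i j)"
    by (rule sum.cong[OF refl], subst bilinear_frame_expansion[of B "g _", OF assms(1,3,4)])
       (simp add: sum_distrib_left mult.assoc case_prod_unfold)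
  finally show ?thesis by (simp add: sum.cartesian_product case_prod_unfold)
qed

text \<open>
  The coordinates of unit vectors lie in \<open>[-1, 1]\<close>.  The cube of such coordinate families is compact by
  Tychonoff's theorem, and the sphere is a closed part of its image under the continuous map that
  sends coordinates to vectors.
\<close>

lemma compact_sphere_of_frame:
  assumes "orthonormal_frame (B :: 'e::real_inner set)"
  shows "compact (sphere (0 :: 'e) 1)"
proof -
  \<comment> \<open>coordinate families are total functions on \<open>'e\<close>, set to \<open>0\<close> off the frame\<close>
  let ?K = "PiE UNIV (\<lambda>b. if b \<in> B then {-1..1} else {0}) :: ('e \<Rightarrow> real) set"
  have "compactin (product_topology (\<lambda>_. euclidean) UNIV) ?K"
    by (subst compactin_PiE) auto
  then have K: "compact ?K"
    by (simp add: euclidean_product_topology)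
  have "continuous_on ?K (\<lambda>f. \<Sum>b\<in>B. f b *\<^sub>R b)"
    by (intro continuous_intros continuous_on_subset[OF continuous_on_product_coordinates]) auto
  then have im: "compact ((\<lambda>f. \<Sum>b\<in>B. f b *\<^sub>R b) ` ?K)"
    using K by (rule compact_continuous_image)
  have "sphere 0 1 \<subseteq> (\<lambda>f. \<Sum>b\<in>B. f b *\<^sub>R b) ` ?K"
  proof
    fix v :: 'e assume v: "v \<in> sphere 0 1"
    let ?f = "\<lambda>b. if b \<in> B then v \<bullet> b else 0"
    have "?f \<in> ?K"
      using frame_inner_le_norm[OF assms, of _ v] v by (force simp: abs_le_iff)
    moreover have "v = (\<Sum>b\<in>B. ?f b *\<^sub>R b)"
      using assms by (simp add: orthonormal_frame_def)
    ultimately show "v \<in> (\<lambda>f. \<Sum>b\<in>B. f b *\<^sub>R b) ` ?K"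
      by (intro image_eqI[of _ _ ?f])
  qed
  then have eq: "(\<lambda>f. \<Sum>b\<in>B. f b *\<^sub>R b) ` ?K \<inter> sphere 0 1 = sphere 0 1"
    by (rule Int_absorb1)
  have "closed (sphere (0 :: 'e) 1)"
    unfolding sphere_def by (intro closed_Collect_eq continuous_intros)
  then show ?thesis using compact_Int_closed[OF im, of "sphere 0 1"] unfolding eq by simp
qed

text \<open>
  The quadratic form attains a minimum on the compact unit sphere, which is positive; homogeneity
  extends the bound to all vectors.
\<close>

lemma positive_definite_lower_bound:
  fixes g :: "'e::real_inner \<Rightarrow> 'e \<Rightarrow> real"
  assumes B: "orthonormal_frame (B :: 'e set)" and lin: "\<And>v. linear (\<lambda>u. g u v)" "\<And>u. linear (g u)"
    and pos: "\<And>u. u \<noteq> 0 \<Longrightarrow> g u u > 0"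
  shows "\<exists>l>0. \<forall>u. l * (norm u)\<^sup>2 \<le> g u u"
proof (cases "sphere (0::'e) 1 = {}")
  \<comment> \<open>the sphere is empty exactly in dimension \<open>0\<close>, where any constant will do\<close>
  case True
  have zero: "u = 0" for u :: 'e
  proof (rule ccontr)
    assume "u \<noteq> 0"
    then have "u /\<^sub>R norm u \<in> sphere 0 1" by simp
    then show False using True by blast
  qed
  have "1 * (norm u)\<^sup>2 \<le> g u u" for u
    unfolding zero[of u] using linear_0[OF lin(2), of 0] by simp
  then show ?thesis using zero_less_one by blast
next
  case False
  have expansion: "(\<lambda>u. g u u) = (\<lambda>u. \<Sum>p\<in>B \<times> B. ((u \<bullet> fst p) * (u \<bullet> snd p)) * g (fst p) (snd p))"
    by (rule ext, rule bilinear_frame_expansion[of B g, OF B lin, unfolded case_prod_unfold])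
  have "continuous_on (sphere 0 1) (\<lambda>u. g u u)"
    by (subst expansion) (intro continuous_intros)
  then obtain u0 where u0: "u0 \<in> sphere 0 1" "\<And>u. u \<in> sphere 0 1 \<Longrightarrow> g u0 u0 \<le> g u u"
    using continuous_attains_inf[OF compact_sphere_of_frame[OF B] False] by blast
  have "g u0 u0 * (norm u)\<^sup>2 \<le> g u u" for u
  proof (cases "u = 0")
    case True
    then show ?thesis using linear_0[OF lin(2)] by simp
  next
    case False
    define e where "e = u /\<^sub>R norm u"
    have e: "e \<in> sphere 0 1" "u = norm u *\<^sub>R e" using False by (simp_all add: e_def)
    have "g (c *\<^sub>R e) (c *\<^sub>R e) = c\<^sup>2 * g e e" for c
      using linear_cmul[OF lin(1), of c e "c *\<^sub>R e"] linear_cmul[OF lin(2), of e c e]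
      by (simp add: power2_eq_square)
    then have "g u u = (norm u)\<^sup>2 * g e e" using e(2) by metis
    also have "\<dots> \<ge> (norm u)\<^sup>2 * g u0 u0"
      using u0(2)[OF e(1)] by (intro mult_left_mono) auto
    finally show ?thesis by (simp add: mult.commute)
  qed
  moreover have "g u0 u0 > 0" using u0(1) by (intro pos) auto
  ultimately show ?thesis by blast
qed

section \<open>Smooth maps\<close>

lemma smooth_on_differentiable:
  assumes "smooth_on S f" "x \<in> S"
  shows "f differentiable (at x)"
  using assms by (auto simp: smooth_on_def dest: spec[of _ "Suc 0"])

lemma smooth_on_directional_derivative:
  assumes "smooth_on S f"
  shows "smooth_on S (\<lambda>x. frechet_derivative f (at x) v)"
  unfolding smooth_on_def
proof
  fix k
  have "Ck_on (Suc k) S f" using assms by (simp only: smooth_on_def)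
  then show "Ck_on k S (\<lambda>x. frechet_derivative f (at x) v)" by simp
qed

lemma smooth_on_continuous:
  assumes "smooth_on S f"
  shows "continuous_on S f"
proof -
  have "Ck_on 0 S f" using assms by (simp only: smooth_on_def)
  then show ?thesis by simp
qed

text \<open>
  Openness of \<open>S\<close> is essential: the derivatives of \<open>f\<close> and \<open>g\<close> at a point of \<open>S\<close> depend on their values
  in a neighbourhood of it.
\<close>

lemma Ck_on_cong:
  assumes "Ck_on k S f" "open S" "\<And>x. x \<in> S \<Longrightarrow> f x = g x"
  shows "Ck_on k S g"
  using assms
proof (induction k arbitrary: f g)
  case 0
  then show ?case by (simp cong: continuous_on_cong_simp)
next
  case (Suc k)
  have df: "f differentiable (at x)" if "x \<in> S" for x using Suc.prems(1) that by simp
  have dg: "g differentiable (at x)" if "x \<in> S" for x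
  proof -
    obtain D where "(f has_derivative D) (at x)" using df[OF \<open>x \<in> S\<close>] unfolding differentiable_def by blast
    then have "(g has_derivative D) (at x)"
      by (rule has_derivative_transform_within_open[OF _ Suc.prems(2) that Suc.prems(3)])
    then show ?thesis unfolding differentiable_def by blast
  qed
  have eq: "frechet_derivative f (at x) = frechet_derivative g (at x)" if "x \<in> S" for x
    by (rule frechet_derivative_transform_within_open[OF df[OF that] Suc.prems(2) that Suc.prems(3)])
  have "Ck_on k S (\<lambda>x. frechet_derivative g (at x) v)" for v
  proof (rule Suc.IH[OF _ Suc.prems(2)])
    show "Ck_on k S (\<lambda>x. frechet_derivative f (at x) v)" using Suc.prems(1) by simp
  qed (simp add: eq)
  with dg show ?case by simp
qed

lemma smooth_on_cong:
  assumes "smooth_on S f" "open S" "\<And>x. x \<in> S \<Longrightarrow> f x = g x"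
  shows "smooth_on S g"
  unfolding smooth_on_def
proof
  fix k
  have "Ck_on k S f" using assms(1) by (simp only: smooth_on_def)
  then show "Ck_on k S g" by (rule Ck_on_cong) (use assms in auto)
qed

lemma smooth_on_vector_derivative:
  assumes "smooth_on S f" "open S"
  shows "smooth_on S (\<lambda>t. vector_derivative f (at t))"
proof (rule smooth_on_cong[OF smooth_on_directional_derivative[OF assms(1), of 1] assms(2)])
  fix t assume "t \<in> S"
  then show "frechet_derivative f (at t) 1 = vector_derivative f (at t)"
    using frechet_derivative_eq_vector_derivative[OF smooth_on_differentiable[OF assms(1)]] by simp
qed

lemma smooth_on_has_vector_derivative:
  assumes "smooth_on S f" "t \<in> S"
  shows "(f has_vector_derivative vector_derivative f (at t)) (at t)"
  using smooth_on_differentiable[OF assms] by (simp add: vector_derivative_works)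

lemma vector_derivative_cong_open:
  assumes "open S" "t \<in> S" "\<And>s. s \<in> S \<Longrightarrow> f s = g s"
  shows "vector_derivative f (at t) = vector_derivative g (at t)"
proof (rule vector_derivative_cong_eq)
  show "eventually (\<lambda>s. s \<in> UNIV \<longrightarrow> f s = g s) (nhds t)"
    using eventually_nhds_in_open[OF assms(1,2)] by eventually_elim (simp add: assms(3))
qed auto

lemma isCont_eventually_in_open:
  assumes "isCont f t" "open U" "f t \<in> U"
  shows "eventually (\<lambda>s. f s \<in> U) (nhds t)"
  using topological_tendstoD[of f "f t" "nhds t" U] assms tendsto_at_iff_tendsto_nhds[of f t]
  by (simp add: isCont_def)

section \<open>Locally Lipschitz coefficients\<close>

text \<open>
  One constant \<open>K\<close> bounds both the values and the increments, so that finite families and linear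
  combinations need a single pair \<open>(K, r)\<close>.
\<close>

definition lipschitz_near :: "'e::real_normed_vector \<Rightarrow> ('e \<Rightarrow> real) \<Rightarrow> bool" where
  "lipschitz_near x0 f \<longleftrightarrow>
     (\<exists>K r. r > 0 \<and> (\<forall>x\<in>ball x0 r. \<forall>y\<in>ball x0 r. \<bar>f x\<bar> \<le> K \<and> \<bar>f x - f y\<bar> \<le> K * norm (x - y)))"

lemma lipschitz_near_add:
  assumes "lipschitz_near x0 f" "lipschitz_near x0 g"
  shows "lipschitz_near x0 (\<lambda>x. f x + g x)"
proof -
  obtain K r where 1: "r > 0" "\<And>x y. x \<in> ball x0 r \<Longrightarrow> y \<in> ball x0 r \<Longrightarrow> \<bar>f x\<bar> \<le> K \<and> \<bar>f x - f y\<bar> \<le> K * norm (x - y)"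
    using assms(1) unfolding lipschitz_near_def by blast
  obtain K' r' where 2: "r' > 0" "\<And>x y. x \<in> ball x0 r' \<Longrightarrow> y \<in> ball x0 r' \<Longrightarrow> \<bar>g x\<bar> \<le> K' \<and> \<bar>g x - g y\<bar> \<le> K' * norm (x - y)"
    using assms(2) unfolding lipschitz_near_def by blast
  show ?thesis
    unfolding lipschitz_near_def
  proof (rule exI[of _ "K + K'"], rule exI[of _ "min r r'"], intro conjI ballI)
    fix x y assume "x \<in> ball x0 (min r r')" "y \<in> ball x0 (min r r')"
    then have "\<bar>f x\<bar> \<le> K" "\<bar>f x - f y\<bar> \<le> K * norm (x - y)" "\<bar>g x\<bar> \<le> K'" "\<bar>g x - g y\<bar> \<le> K' * norm (x - y)"
      using 1(2)[of x y] 2(2)[of x y] by auto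
    then show "\<bar>f x + g x\<bar> \<le> K + K'" "\<bar>f x + g x - (f y + g y)\<bar> \<le> (K + K') * norm (x - y)"
      by (simp_all add: distrib_right)
  qed (use 1 2 in auto)
qed

lemma lipschitz_near_cmult:
  assumes "lipschitz_near x0 f"
  shows "lipschitz_near x0 (\<lambda>x. a * f x)"
proof -
  obtain K r where 1: "r > 0" "\<And>x y. x \<in> ball x0 r \<Longrightarrow> y \<in> ball x0 r \<Longrightarrow> \<bar>f x\<bar> \<le> K \<and> \<bar>f x - f y\<bar> \<le> K * norm (x - y)"
    using assms(1) unfolding lipschitz_near_def by blast
  show ?thesis
    unfolding lipschitz_near_def
  proof (rule exI[of _ "\<bar>a\<bar> * K"], rule exI[of _ r], intro conjI ballI 1(1))
    fix x y assume xy: "x \<in> ball x0 r" "y \<in> ball x0 r"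
    show "\<bar>a * f x\<bar> \<le> \<bar>a\<bar> * K"
      using 1(2)[OF xy] by (simp add: abs_mult mult_left_mono)
    have "\<bar>a * f x - a * f y\<bar> = \<bar>a\<bar> * \<bar>f x - f y\<bar>"
      by (simp add: abs_mult right_diff_distrib[symmetric])
    also have "\<dots> \<le> \<bar>a\<bar> * (K * norm (x - y))"
      using 1(2)[OF xy] by (intro mult_left_mono) auto
    finally show "\<bar>a * f x - a * f y\<bar> \<le> \<bar>a\<bar> * K * norm (x - y)" by (simp add: mult.assoc)
  qed
qed

text \<open>
  Near \<open>x0\<close> the finitely many derivatives in the directions of the frame are bounded by continuity.
  Expanding a vector in the frame, this bounds the operator norm of the derivative, and the mean value
  inequality on a ball gives the Lipschitz estimate.
\<close>

lemma smooth_on_lipschitz_near: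
  fixes f :: "'e::real_inner \<Rightarrow> real"
  assumes B: "orthonormal_frame (B :: 'e set)" and V: "open V" "x0 \<in> V" and f: "smooth_on V f"
  shows "lipschitz_near x0 f"
proof -
  let ?D = "\<lambda>x. frechet_derivative f (at x)"
  have fin: "finite B" using B by (simp add: orthonormal_frame_def)
  have near: "eventually (\<lambda>x. \<bar>g x\<bar> < \<bar>g x0\<bar> + 1) (nhds x0)" if "smooth_on V g" for g :: "'e \<Rightarrow> real"
  proof -
    have "continuous_on V (\<lambda>x. \<bar>g x\<bar>)"
      by (intro continuous_intros smooth_on_continuous that)
    then have "isCont (\<lambda>x. \<bar>g x\<bar>) x0"
      using V by (simp add: continuous_on_eq_continuous_at)
    then have "((\<lambda>x. \<bar>g x\<bar>) \<longlongrightarrow> \<bar>g x0\<bar>) (nhds x0)"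
      using tendsto_at_iff_tendsto_nhds[of "\<lambda>x. \<bar>g x\<bar>" x0] by (simp add: isCont_def)
    then show ?thesis by (rule order_tendstoD) simp
  qed
  have "eventually (\<lambda>x. \<forall>b\<in>B. \<bar>?D x b\<bar> < \<bar>?D x0 b\<bar> + 1) (nhds x0)"
    by (intro eventually_ball_finite fin ballI near smooth_on_directional_derivative f)
  moreover have "eventually (\<lambda>x. x \<in> V) (nhds x0)" using V by (rule eventually_nhds_in_open)
  ultimately have "eventually (\<lambda>x. x \<in> V \<and> (\<forall>b\<in>B. \<bar>?D x b\<bar> < \<bar>?D x0 b\<bar> + 1) \<and> \<bar>f x\<bar> < \<bar>f x0\<bar> + 1) (nhds x0)"
    using near[OF f] by eventually_elim blast
  then obtain r where r: "r > 0" and R: "\<And>x. dist x x0 < r \<Longrightarrow>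
      x \<in> V \<and> (\<forall>b\<in>B. \<bar>?D x b\<bar> < \<bar>?D x0 b\<bar> + 1) \<and> \<bar>f x\<bar> < \<bar>f x0\<bar> + 1"
    unfolding eventually_nhds_metric by blast
  \<comment> \<open>a bound for the operator norm of the derivative at every point of the ball\<close>
  define M where "M = (\<Sum>b\<in>B. \<bar>?D x0 b\<bar> + 1)"
  have M: "M \<ge> 0" unfolding M_def by (intro sum_nonneg) auto
  have lip: "\<bar>f x - f y\<bar> \<le> M * norm (x - y)" if xy: "x \<in> ball x0 r" "y \<in> ball x0 r" for x y
  proof -
    have der: "(f has_derivative ?D z) (at z)" if "z \<in> ball x0 r" for z
      using R[of z] that smooth_on_differentiable[OF f] by (simp add: dist_commute frechet_derivative_works)
    have "norm (f x - f y) \<le> M * norm (x - y)"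
    proof (rule differentiable_bound[of "ball x0 r" f ?D])
      fix z assume z: "z \<in> ball x0 r"
      show "(f has_derivative ?D z) (at z within ball x0 r)"
        using der[OF z] by (rule has_derivative_at_withinI)
      have lin: "linear (?D z)" using has_derivative_linear[OF der[OF z]] .
      show "onorm (?D z) \<le> M"
      proof (rule onorm_bound[OF M])
        fix v
        have "?D z v = (\<Sum>b\<in>B. (v \<bullet> b) *\<^sub>R ?D z b)"
          by (rule linear_frame_expansion[OF B lin])
        also have "norm \<dots> \<le> (\<Sum>b\<in>B. norm v * (\<bar>?D x0 b\<bar> + 1))"
        proof (rule order_trans[OF norm_sum sum_mono])
          fix b assume b: "b \<in> B"
          have "\<bar>?D z b\<bar> \<le> \<bar>?D x0 b\<bar> + 1"
            using R[of z] z b by (force simp: dist_commute)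
          then show "norm ((v \<bullet> b) *\<^sub>R ?D z b) \<le> norm v * (\<bar>?D x0 b\<bar> + 1)"
            using frame_inner_le_norm[OF B b, of v] by (auto simp: abs_mult intro: mult_mono)
        qed
        also have "\<dots> = M * norm v" by (simp add: M_def sum_distrib_left mult.commute)
        finally show "norm (?D z v) \<le> M * norm v" .
      qed
    qed (use xy in auto)
    then show ?thesis by simp
  qed
  show ?thesis
    unfolding lipschitz_near_def
  proof (rule exI[of _ "M + \<bar>f x0\<bar> + 1"], rule exI[of _ r], intro conjI r ballI)
    fix x y assume xy: "x \<in> ball x0 r" "y \<in> ball x0 r"
    show "\<bar>f x\<bar> \<le> M + \<bar>f x0\<bar> + 1" using R[of x] xy M by (force simp: dist_commute)
    have "M * norm (x - y) \<le> (M + \<bar>f x0\<bar> + 1) * norm (x - y)"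
      by (intro mult_right_mono) auto
    then show "\<bar>f x - f y\<bar> \<le> (M + \<bar>f x0\<bar> + 1) * norm (x - y)"
      using lip[OF xy] by linarith
  qed
qed

text \<open>
  A uniform form of the Lipschitz property for linear combinations of the coefficients \<open>c\<close>.  With the
  products of coordinates of some vectors as \<open>\<alpha>\<close>, it bounds a multilinear form and its dependence on
  the base point by multiples of the product \<open>A\<close> of the norms of these vectors.
\<close>

definition combination_bound :: "'i set \<Rightarrow> ('i \<Rightarrow> 'e::real_normed_vector \<Rightarrow> real) \<Rightarrow> 'e set \<Rightarrow> real \<Rightarrow> bool" where
  "combination_bound I c S K \<longleftrightarrow>
     (\<forall>x\<in>S. \<forall>y\<in>S. \<forall>\<alpha> A. (\<forall>i\<in>I. \<bar>\<alpha> i\<bar> \<le> A) \<longrightarrow>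
        \<bar>\<Sum>i\<in>I. \<alpha> i * c i x\<bar> \<le> K * A \<and>
        \<bar>(\<Sum>i\<in>I. \<alpha> i * c i x) - (\<Sum>i\<in>I. \<alpha> i * c i y)\<bar> \<le> K * A * norm (x - y))"

lemma combination_boundD:
  assumes "combination_bound I c S K" "x \<in> S" "y \<in> S" "\<And>i. i \<in> I \<Longrightarrow> \<bar>\<alpha> i\<bar> \<le> A"
  shows "\<bar>\<Sum>i\<in>I. \<alpha> i * c i x\<bar> \<le> K * A"
    "\<bar>(\<Sum>i\<in>I. \<alpha> i * c i x) - (\<Sum>i\<in>I. \<alpha> i * c i y)\<bar> \<le> K * A * norm (x - y)"
  using assms unfolding combination_bound_def by simp_all

lemma lipschitz_near_combinations:
  fixes c :: "'i \<Rightarrow> 'e::real_normed_vector \<Rightarrow> real"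
  assumes "finite I" "\<And>i. i \<in> I \<Longrightarrow> lipschitz_near x0 (c i)"
  shows "\<exists>K r. K \<ge> 0 \<and> r > 0 \<and> combination_bound I c (ball x0 r) K"
  using assms
proof (induction I rule: finite_induct)
  case empty
  show ?case
    by (rule exI[of _ 0], rule exI[of _ 1]) (simp add: combination_bound_def)
next
  case (insert j I)
  have "\<exists>K r. K \<ge> 0 \<and> r > 0 \<and> combination_bound I c (ball x0 r) K"
    by (rule insert.IH) (simp add: insert.prems)
  then obtain K r where K: "K \<ge> 0" "r > 0" and Kb: "combination_bound I c (ball x0 r) K"
    by blast
  have "lipschitz_near x0 (c j)" using insert.prems by simp
  then obtain K' r' where K': "r' > 0" and Kb': "\<And>x y. x \<in> ball x0 r' \<Longrightarrow> y \<in> ball x0 r' \<Longrightarrow>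
      \<bar>c j x\<bar> \<le> K' \<and> \<bar>c j x - c j y\<bar> \<le> K' * norm (x - y)"
    unfolding lipschitz_near_def by blast
  have "x0 \<in> ball x0 r'" using K' by simp
  then have "K' \<ge> 0" using Kb'[of x0 x0] abs_ge_zero[of "c j x0"] by linarith
  have "combination_bound (insert j I) c (ball x0 (min r r')) (K + K')"
    unfolding combination_bound_def
  proof (intro ballI allI impI)
    fix x y :: 'e and \<alpha> :: "'i \<Rightarrow> real" and A :: real
    assume xy: "x \<in> ball x0 (min r r')" "y \<in> ball x0 (min r r')" and A: "\<forall>i\<in>insert j I. \<bar>\<alpha> i\<bar> \<le> A"
    have 1: "\<bar>\<Sum>i\<in>I. \<alpha> i * c i x\<bar> \<le> K * A"
      "\<bar>(\<Sum>i\<in>I. \<alpha> i * c i x) - (\<Sum>i\<in>I. \<alpha> i * c i y)\<bar> \<le> K * A * norm (x - y)"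
      using combination_boundD[OF Kb, of x y \<alpha> A] xy A by auto
    have 2: "\<bar>c j x\<bar> \<le> K'" "\<bar>c j x - c j y\<bar> \<le> K' * norm (x - y)"
      using Kb'[of x y] xy by auto
    have j: "\<bar>\<alpha> j\<bar> \<le> A" using A by auto
    have 3: "\<bar>\<alpha> j * c j x\<bar> \<le> A * K'" "\<bar>\<alpha> j * (c j x - c j y)\<bar> \<le> A * (K' * norm (x - y))"
      unfolding abs_mult using j abs_ge_zero[of "\<alpha> j"] by (intro mult_mono 2 abs_ge_zero; linarith)+
    have split: "(\<Sum>i\<in>insert j I. \<alpha> i * c i z) = \<alpha> j * c j z + (\<Sum>i\<in>I. \<alpha> i * c i z)" for z
      using insert.hyps by simp
    have "\<alpha> j * c j x - \<alpha> j * c j y = \<alpha> j * (c j x - c j y)"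
      by (rule right_diff_distrib[symmetric])
    moreover have "(K + K') * A = K * A + A * K'"
      "(K + K') * A * norm (x - y) = K * A * norm (x - y) + A * (K' * norm (x - y))"
      by (simp_all add: distrib_right)
    ultimately show "\<bar>\<Sum>i\<in>insert j I. \<alpha> i * c i x\<bar> \<le> (K + K') * A \<and>
        \<bar>(\<Sum>i\<in>insert j I. \<alpha> i * c i x) - (\<Sum>i\<in>insert j I. \<alpha> i * c i y)\<bar> \<le> (K + K') * A * norm (x - y)"
      unfolding split using 1 3 by (intro conjI) linarith+
  qed
  then show ?case
    using K K' \<open>K' \<ge> 0\<close> by (intro exI[of _ "K + K'"] exI[of _ "min r r'"]) simp
qed

section \<open>Uniqueness for second-order equations\<close>

text \<open>
  Gronwall's argument: \<open>D t * exp (- K * t)\<close> is nonincreasing to the right of \<open>t0\<close> and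
  \<open>D t * exp (K * t)\<close> is nondecreasing to its left, so the nonnegative function \<open>D\<close> cannot leave \<open>0\<close> in
  either direction.
\<close>

lemma zero_of_derivative_bounded_by_self:
  fixes D D' :: "real \<Rightarrow> real"
  assumes der: "\<And>t. \<bar>t - t0\<bar> < e \<Longrightarrow> (D has_real_derivative D' t) (at t)"
    and bound: "\<And>t. \<bar>t - t0\<bar> < e \<Longrightarrow> \<bar>D' t\<bar> \<le> K * D t"
    and nonneg: "\<And>t. D t \<ge> 0" and zero: "D t0 = 0" and t: "\<bar>t - t0\<bar> < e"
  shows "D t = 0"
proof (cases "t0 \<le> t")
  case True
  have "D t0 * exp (- K * t0) \<ge> D t * exp (- K * t)"
  proof (rule DERIV_nonpos_imp_nonincreasing[OF True])
    fix s assume s: "t0 \<le> s" "s \<le> t"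
    then have s': "\<bar>s - t0\<bar> < e" using t by auto
    have "((\<lambda>s. D s * exp (- K * s)) has_real_derivative
        D' s * exp (- K * s) + D s * (exp (- K * s) * (- K))) (at s)"
      by (auto intro!: derivative_eq_intros der[OF s'])
    moreover have "D' s * exp (- K * s) + D s * (exp (- K * s) * (- K)) = (D' s - K * D s) * exp (- K * s)"
      by (simp add: algebra_simps)
    moreover have "\<dots> \<le> 0"
      using bound[OF s'] by (intro mult_nonpos_nonneg) auto
    ultimately show "\<exists>y. ((\<lambda>s. D s * exp (- K * s)) has_real_derivative y) (at s) \<and> y \<le> 0"
      by metis
  qed
  then have "D t \<le> 0" by (simp add: zero mult_le_0_iff)
  then show ?thesis using nonneg[of t] by linarith
next
  case False
  then have "t \<le> t0" by simp
  have "D t * exp (K * t) \<le> D t0 * exp (K * t0)"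
  proof (rule DERIV_nonneg_imp_nondecreasing[OF \<open>t \<le> t0\<close>])
    fix s assume s: "t \<le> s" "s \<le> t0"
    then have s': "\<bar>s - t0\<bar> < e" using t by auto
    have "((\<lambda>s. D s * exp (K * s)) has_real_derivative
        D' s * exp (K * s) + D s * (exp (K * s) * K)) (at s)"
      by (auto intro!: derivative_eq_intros der[OF s'])
    moreover have "D' s * exp (K * s) + D s * (exp (K * s) * K) = (D' s + K * D s) * exp (K * s)"
      by (simp add: algebra_simps)
    moreover have "\<dots> \<ge> 0"
      using bound[OF s'] by (intro mult_nonneg_nonneg) auto
    ultimately show "\<exists>y. ((\<lambda>s. D s * exp (K * s)) has_real_derivative y) (at s) \<and> 0 \<le> y"
      by metis
  qed
  then have "D t \<le> 0" by (simp add: zero mult_le_0_iff)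
  then show ?thesis using nonneg[of t] by linarith
qed

text \<open>
  Gronwall's argument is applied to \<open>D = |x - y|\<^sup>2 + |x' - y'|\<^sup>2\<close>, the squared distance in phase
  space.  Only a Lipschitz comparison of the two accelerations is required, not an explicit right-hand
  side, because for geodesics the acceleration is only known implicitly.
\<close>

lemma second_order_uniqueness:
  fixes x y x' y' x'' y'' :: "real \<Rightarrow> 'e::real_inner"
  assumes x: "\<And>t. \<bar>t - t0\<bar> < e \<Longrightarrow> (x has_vector_derivative x' t) (at t)"
      "\<And>t. \<bar>t - t0\<bar> < e \<Longrightarrow> (x' has_vector_derivative x'' t) (at t)"
    and y: "\<And>t. \<bar>t - t0\<bar> < e \<Longrightarrow> (y has_vector_derivative y' t) (at t)"
      "\<And>t. \<bar>t - t0\<bar> < e \<Longrightarrow> (y' has_vector_derivative y'' t) (at t)"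
    and lip: "\<And>t. \<bar>t - t0\<bar> < e \<Longrightarrow>
      norm (x'' t - y'' t) \<le> L * (norm (x t - y t) + norm (x' t - y' t))"
    and L: "L \<ge> 0"
    and init: "x t0 = y t0" "x' t0 = y' t0" and t: "\<bar>t - t0\<bar> < e"
  shows "x t = y t"
proof -
  define w where "w t = x t - y t" for t
  define u where "u t = x' t - y' t" for t
  define z where "z t = x'' t - y'' t" for t
  define D where "D t = w t \<bullet> w t + u t \<bullet> u t" for t
  have "D t = 0"
  proof (rule zero_of_derivative_bounded_by_self[where D = D and t = t and t0 = t0 and e = e and K = "1 + 3 * L"
        and D' = "\<lambda>t. 2 * (w t \<bullet> u t) + 2 * (u t \<bullet> z t)"])
    fix t assume t: "\<bar>t - t0\<bar> < e"
    have "(w has_vector_derivative u t) (at t)" "(u has_vector_derivative z t) (at t)"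
      unfolding w_def[abs_def] u_def[abs_def] z_def
      by (intro has_vector_derivative_diff x y t)+
    then show "(D has_real_derivative 2 * (w t \<bullet> u t) + 2 * (u t \<bullet> z t)) (at t)"
      unfolding D_def[abs_def] has_vector_derivative_def has_field_derivative_def
      by (auto intro!: derivative_eq_intros simp: fun_eq_iff inner_commute algebra_simps)
    have 1: "\<bar>w t \<bullet> u t\<bar> \<le> norm (w t) * norm (u t)" "\<bar>u t \<bullet> z t\<bar> \<le> norm (u t) * norm (z t)"
      by (rule Cauchy_Schwarz_ineq2)+
    have "norm (u t) * norm (z t) \<le> norm (u t) * (L * (norm (w t) + norm (u t)))"
      using lip[OF t] by (intro mult_left_mono) (auto simp: w_def u_def z_def)
    then have 2: "norm (u t) * norm (z t) \<le> L * (norm (w t) * norm (u t)) + L * (norm (u t))\<^sup>2"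
      by (simp add: algebra_simps power2_eq_square)
    have 3: "2 * (norm (w t) * norm (u t)) \<le> D t"
      using sum_squares_bound[of "norm (w t)" "norm (u t)"]
      by (simp add: D_def power2_norm_eq_inner mult.assoc)
    have "(norm (u t))\<^sup>2 \<le> D t" by (simp add: D_def power2_norm_eq_inner)
    then have "L * (norm (u t))\<^sup>2 \<le> L * D t" "L * (2 * (norm (w t) * norm (u t))) \<le> L * D t"
      using 3 L by (auto intro: mult_left_mono)
    then show "\<bar>2 * (w t \<bullet> u t) + 2 * (u t \<bullet> z t)\<bar> \<le> (1 + 3 * L) * D t"
      using 1 2 3 by (simp add: distrib_right)
  qed (use t init in \<open>auto simp: D_def w_def u_def\<close>)
  then have "w t = 0"
    by (simp add: D_def add_nonneg_eq_0_iff)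
  then show ?thesis by (simp add: w_def)
qed

text \<open>
  This is the estimate behind uniqueness of geodesics, with \<open>G\<close> the metric and \<open>\<Gamma>\<close> the Christoffel
  symbols of the first kind.  Testing both equations against \<open>z = a - a'\<close> and subtracting expresses
  \<open>G x z z\<close> through the variation of \<open>G\<close> and \<open>\<Gamma>\<close> between \<open>x\<close> and \<open>y\<close> and through \<open>v - v'\<close>, each time with a
  factor \<open>z\<close>.  Uniform positivity bounds \<open>G x z z\<close> below by a multiple of \<open>|z|\<^sup>2\<close>, and one factor \<open>|z|\<close>
  cancels.  In this way the metric never has to be inverted.
\<close>

lemma implicit_quadratic_equation_lipschitz:
  fixes G :: "'e::real_inner \<Rightarrow> 'e \<Rightarrow> 'e \<Rightarrow> real" and \<Gamma> :: "'e \<Rightarrow> 'e \<Rightarrow> 'e \<Rightarrow> 'e \<Rightarrow> real"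
  assumes B: "orthonormal_frame (B :: 'e set)" and V: "open V" "x0 \<in> V"
    and Glin: "\<And>x v. x \<in> V \<Longrightarrow> linear (\<lambda>u. G x u v)" "\<And>x u. x \<in> V \<Longrightarrow> linear (G x u)"
    and \<Gamma>lin: "\<And>x v w. x \<in> V \<Longrightarrow> linear (\<lambda>u. \<Gamma> x u v w)" "\<And>x u w. x \<in> V \<Longrightarrow> linear (\<lambda>v. \<Gamma> x u v w)"
      "\<And>x u v. x \<in> V \<Longrightarrow> linear (\<Gamma> x u v)"
    and Glip: "\<And>u v. lipschitz_near x0 (\<lambda>x. G x u v)"
    and \<Gamma>lip: "\<And>u v w. lipschitz_near x0 (\<lambda>x. \<Gamma> x u v w)"
    and pos: "\<And>u. u \<noteq> 0 \<Longrightarrow> G x0 u u > 0" and N: "N \<ge> 0"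
  shows "\<exists>r L. r > 0 \<and> L \<ge> 0 \<and> (\<forall>x\<in>ball x0 r. \<forall>y\<in>ball x0 r. \<forall>v v' a a'.
      norm v \<le> N \<and> norm v' \<le> N \<and> norm a' \<le> N \<and>
      (\<forall>w. G x a w + \<Gamma> x v v w = 0) \<and> (\<forall>w. G y a' w + \<Gamma> y v' v' w = 0) \<longrightarrow>
      norm (a - a') \<le> L * (norm (x - y) + norm (v - v')))"
proof -
  have fin: "finite B" using B by (simp add: orthonormal_frame_def)
  have inn: "\<bar>v \<bullet> b\<bar> \<le> norm v" if "b \<in> B" for v b
    using frame_inner_le_norm[OF B that] .
  have "\<exists>K r. K \<ge> 0 \<and> r > 0 \<and> combination_bound (B \<times> B) (\<lambda>(i, j) x. G x i j) (ball x0 r) K"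
    by (rule lipschitz_near_combinations) (auto simp: fin Glip)
  then obtain K1 r1 where K1: "K1 \<ge> 0" "r1 > 0"
    and C1: "combination_bound (B \<times> B) (\<lambda>(i, j) x. G x i j) (ball x0 r1) K1" by blast
  have "\<exists>K r. K \<ge> 0 \<and> r > 0 \<and> combination_bound (B \<times> B \<times> B) (\<lambda>(k, i, j) x. \<Gamma> x k i j) (ball x0 r) K"
    by (rule lipschitz_near_combinations) (auto simp: fin \<Gamma>lip)
  then obtain K2 r2 where K2: "K2 \<ge> 0" "r2 > 0"
    and C2: "combination_bound (B \<times> B \<times> B) (\<lambda>(k, i, j) x. \<Gamma> x k i j) (ball x0 r2) K2" by blast
  obtain r3 where r3: "r3 > 0" "ball x0 r3 \<subseteq> V" using V openE by blast
  obtain l where l: "l > 0" and lower0: "\<And>u. l * (norm u)\<^sup>2 \<le> G x0 u u"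
    using positive_definite_lower_bound[OF B Glin(1)[OF V(2)] Glin(2)[OF V(2)] pos] by blast
  \<comment> \<open>the last radius keeps the variation of \<open>G\<close> below \<open>l / 2\<close>; the summand \<open>1\<close> avoids division by \<open>K1 = 0\<close>\<close>
  define r where "r = Min {r1, r2, r3, l / (2 * (K1 + 1))}"
  have r: "r > 0" "r \<le> r1" "r \<le> r2" "r \<le> r3" "r \<le> l / (2 * (K1 + 1))"
    using K1 K2 r3 l by (auto simp: r_def)
  have inV: "x \<in> V" if "x \<in> ball x0 r" for x using that r r3 by auto
  have Gdiff: "\<bar>G x a b - G y a b\<bar> \<le> K1 * (norm a * norm b) * norm (x - y)"
    if "x \<in> ball x0 r" "y \<in> ball x0 r" for x y a b
  proof -
    have e: "G z a b = (\<Sum>p\<in>B \<times> B. (case p of (i, j) \<Rightarrow> (a \<bullet> i) * (b \<bullet> j)) * (case p of (i, j) \<Rightarrow> \<lambda>x. G x i j) z)"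
      if "z \<in> V" for z
      using bilinear_frame_expansion[of B "G z", OF B Glin(1)[OF that] Glin(2)[OF that], of a b]
      by (simp add: case_prod_unfold)
    show ?thesis
      unfolding e[OF inV[OF that(1)]] e[OF inV[OF that(2)]]
      using that r by (intro combination_boundD(2)[OF C1]) (auto simp: abs_mult intro!: mult_mono inn)
  qed
  have \<Gamma>both: "\<bar>\<Gamma> x u v w\<bar> \<le> K2 * (norm u * (norm v * norm w))"
    "\<bar>\<Gamma> x u v w - \<Gamma> y u v w\<bar> \<le> K2 * (norm u * (norm v * norm w)) * norm (x - y)"
    if "x \<in> ball x0 r" "y \<in> ball x0 r" for x y u v w
  proof -
    have e: "\<Gamma> z u v w = (\<Sum>p\<in>B \<times> B \<times> B. (case p of (k, i, j) \<Rightarrow> (u \<bullet> k) * ((v \<bullet> i) * (w \<bullet> j))) *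
        (case p of (k, i, j) \<Rightarrow> \<lambda>x. \<Gamma> x k i j) z)"
      if "z \<in> V" for z
      using trilinear_frame_expansion[of B "\<Gamma> z", OF B \<Gamma>lin(1)[OF that] \<Gamma>lin(2)[OF that] \<Gamma>lin(3)[OF that], of u v w]
      by (simp add: case_prod_unfold)
    show "\<bar>\<Gamma> x u v w\<bar> \<le> K2 * (norm u * (norm v * norm w))"
      unfolding e[OF inV[OF that(1)]]
      using that r by (intro combination_boundD(1)[OF C2, of x y]) (auto simp: abs_mult intro!: mult_mono inn)
    show "\<bar>\<Gamma> x u v w - \<Gamma> y u v w\<bar> \<le> K2 * (norm u * (norm v * norm w)) * norm (x - y)"
      unfolding e[OF inV[OF that(1)]] e[OF inV[OF that(2)]]
      using that r by (intro combination_boundD(2)[OF C2]) (auto simp: abs_mult intro!: mult_mono inn)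
  qed
  have lower: "l / 2 * (norm u)\<^sup>2 \<le> G x u u" if x: "x \<in> ball x0 r" for x u
  proof -
    have x0: "x0 \<in> ball x0 r" using r by simp
    have "K1 * norm (x - x0) \<le> (K1 + 1) * (l / (2 * (K1 + 1)))"
      using x r(5) K1 by (intro mult_mono) (auto simp: dist_norm norm_minus_commute)
    also have "\<dots> = l / 2" using K1 by (simp add: field_simps)
    finally have "K1 * norm (x - x0) * (norm u)\<^sup>2 \<le> l / 2 * (norm u)\<^sup>2" by (rule mult_right_mono) simp
    moreover have "\<bar>G x u u - G x0 u u\<bar> \<le> K1 * norm (x - x0) * (norm u)\<^sup>2"
      using Gdiff[OF x x0, of u u] by (simp add: power2_eq_square mult_ac)
    ultimately show ?thesis using lower0[of u] by linarith
  qed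
  \<comment> \<open>collects the coefficients of \<open>|x - y|\<close> and \<open>|v - v'|\<close> in the estimate of \<open>G x z z\<close> below\<close>
  define K where "K = K1 * N + K2 * (N * N) + 2 * (K2 * N)"
  have K: "K \<ge> 0" "K1 * N + K2 * (N * N) \<le> K" "2 * (K2 * N) \<le> K"
    using K1 K2 N by (auto simp: K_def)
  have main: "norm (a - a') \<le> 2 * K / l * (norm (x - y) + norm (v - v'))"
    if xy: "x \<in> ball x0 r" "y \<in> ball x0 r" and b: "norm v \<le> N" "norm v' \<le> N" "norm a' \<le> N"
      and eq: "\<forall>w. G x a w + \<Gamma> x v v w = 0" "\<forall>w. G y a' w + \<Gamma> y v' v' w = 0" for x y v v' a a'
  proof -
    define z where "z = a - a'"
    define n where "n = norm z"
    have xV: "x \<in> V" using inV xy by blast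
    have "G x z z = G x a z - G x a' z"
      unfolding z_def by (rule linear_diff[OF Glin(1)[OF xV]])
    moreover have "\<Gamma> x (v' - v) v' z = \<Gamma> x v' v' z - \<Gamma> x v v' z"
      by (rule linear_diff[OF \<Gamma>lin(1)[OF xV]])
    moreover have "\<Gamma> x v (v' - v) z = \<Gamma> x v v' z - \<Gamma> x v v z"
      by (rule linear_diff[OF \<Gamma>lin(2)[OF xV]])
    moreover have "G x a z + \<Gamma> x v v z = 0" "G y a' z + \<Gamma> y v' v' z = 0"
      using eq by blast+
    ultimately have "G x z z = - (G x a' z - G y a' z) - (\<Gamma> x v' v' z - \<Gamma> y v' v' z)
        + \<Gamma> x (v' - v) v' z + \<Gamma> x v (v' - v) z" by linarith
    moreover have "\<bar>G x a' z - G y a' z\<bar> \<le> K1 * (N * n) * norm (x - y)"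
      by (rule order_trans[OF Gdiff[OF xy]]) (use b K1 N in \<open>auto simp: n_def intro!: mult_mono\<close>)
    moreover have "\<bar>\<Gamma> x v' v' z - \<Gamma> y v' v' z\<bar> \<le> K2 * (N * (N * n)) * norm (x - y)"
      by (rule order_trans[OF \<Gamma>both(2)[OF xy]]) (use b K2 N in \<open>auto simp: n_def intro!: mult_mono\<close>)
    moreover have "\<bar>\<Gamma> x (v' - v) v' z\<bar> \<le> K2 * (norm (v - v') * (N * n))"
      by (rule order_trans[OF \<Gamma>both(1)[OF xy]])
         (use b K2 N in \<open>auto simp: n_def norm_minus_commute intro!: mult_mono\<close>)
    moreover have "\<bar>\<Gamma> x v (v' - v) z\<bar> \<le> K2 * (N * (norm (v - v') * n))"
      by (rule order_trans[OF \<Gamma>both(1)[OF xy]])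
         (use b K2 N in \<open>auto simp: n_def norm_minus_commute intro!: mult_mono\<close>)
    ultimately have "G x z z \<le> K1 * (N * n) * norm (x - y) + K2 * (N * (N * n)) * norm (x - y)
        + K2 * (norm (v - v') * (N * n)) + K2 * (N * (norm (v - v') * n))" by linarith
    also have "\<dots> = n * ((K1 * N + K2 * (N * N)) * norm (x - y) + 2 * (K2 * N) * norm (v - v'))"
      by (simp add: algebra_simps)
    also have "\<dots> \<le> n * (K * norm (x - y) + K * norm (v - v'))"
      using K by (intro mult_left_mono add_mono mult_right_mono) (auto simp: n_def)
    finally have "l / 2 * n\<^sup>2 \<le> n * (K * norm (x - y) + K * norm (v - v'))"
      using lower[OF xy(1), of z] by (simp add: n_def)
    then have "n * (l / 2 * n) \<le> n * (K * norm (x - y) + K * norm (v - v'))"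
      by (simp add: power2_eq_square mult_ac)
    then have "l / 2 * n \<le> K * norm (x - y) + K * norm (v - v')" if "n > 0"
      using that by (simp only: mult_le_cancel_left_pos)
    moreover have "n \<ge> 0" by (simp add: n_def)
    moreover have "0 \<le> K * norm (x - y) + K * norm (v - v')" using K by simp
    ultimately have "l / 2 * n \<le> K * norm (x - y) + K * norm (v - v')"
      by (cases "n > 0") auto
    then have "n \<le> 2 * K / l * (norm (x - y) + norm (v - v'))"
      using l by (simp add: field_simps)
    then show ?thesis by (simp add: n_def z_def)
  qed
  have "2 * K / l \<ge> 0" using K l by simp
  with main r(1) show ?thesis by blast
qed

section \<open>Charts and tangent vectors\<close>

definition jacobian :: "('m, 'e::real_normed_vector) chart \<Rightarrow> ('m, 'e) chart \<Rightarrow> 'm \<Rightarrow> 'e \<Rightarrow> 'e" where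
  "jacobian c c' p = frechet_derivative (transition c c') (at (snd c p))"

text \<open>
  The derivative of \<open>g(v, w)\<close> at \<open>x\<close> in direction \<open>u\<close>, for constant coordinate vectors \<open>v\<close> and \<open>w\<close>.  Unlike
  the Christoffel symbols it separates the direction of differentiation from the arguments of the
  metric.
\<close>

definition chart_metric_deriv ::
    "('m, 'e::real_normed_vector, 'z) riemannian_structure_scheme \<Rightarrow> ('m, 'e) chart \<Rightarrow> 'e \<Rightarrow> 'e \<Rightarrow> 'e \<Rightarrow> 'e \<Rightarrow> real" where
  "chart_metric_deriv M c x u v w = frechet_derivative (\<lambda>y. chart_metric M c y v w) (at x) u"

lemma christoffel_eq:
  "christoffel M c x u v w =
    (chart_metric_deriv M c x u v w + chart_metric_deriv M c x v u w - chart_metric_deriv M c x w u v) / 2"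
  by (simp add: christoffel_def chart_metric_deriv_def)

context riemannian_manifold
begin

lemma chart_inv_left: "c \<in> atlas M \<Longrightarrow> p \<in> fst c \<Longrightarrow> chart_inv c (snd c p) = p"
  using chart_homeomorphism homeomorphism_apply1 by blast

lemma chart_inv_in: "c \<in> atlas M \<Longrightarrow> x \<in> snd c ` fst c \<Longrightarrow> chart_inv c x \<in> fst c"
  using chart_inv_left by (metis imageE)

lemma chart_at: obtains c where "c \<in> atlas M" "p \<in> fst c"
  using charts_cover by blast

lemma chart_image_of_open:
  assumes c: "c \<in> atlas M" and W: "open W" "W \<subseteq> fst c"
  shows "open (snd c ` W)"
proof -
  have "openin (top_of_set (fst c)) W"
    using W chart_domain_open[OF c] by (simp add: openin_open_eq)
  then have "openin (top_of_set (snd c ` fst c)) (snd c ` W)"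
    by (rule homeomorphism_imp_open_map[OF chart_homeomorphism[OF c]])
  then show ?thesis using chart_image_open[OF c] by (simp add: openin_open_eq)
qed

lemma transition_apply: "c \<in> atlas M \<Longrightarrow> p \<in> fst c \<Longrightarrow> transition c c' (snd c p) = snd c' p"
  by (simp add: transition_def chart_inv_left)

lemma transition_has_derivative:
  assumes "c \<in> atlas M" "c' \<in> atlas M" "p \<in> fst c" "p \<in> fst c'"
  shows "(transition c c' has_derivative jacobian c c' p) (at (snd c p))"
  unfolding jacobian_def frechet_derivative_works[symmetric]
  using smooth_on_differentiable[OF transition_smooth[OF assms(1,2)]] assms by blast

lemma linear_jacobian:
  assumes "c \<in> atlas M" "c' \<in> atlas M" "p \<in> fst c" "p \<in> fst c'"
  shows "linear (jacobian c c' p)"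
  using transition_has_derivative[OF assms] by (rule has_derivative_linear)

lemma jacobian_self:
  assumes c: "c \<in> atlas M" "p \<in> fst c"
  shows "jacobian c c p v = v"
proof -
  have "((\<lambda>x. x) has_derivative (\<lambda>v. v)) (at (snd c p))" by (rule has_derivative_ident)
  then have "(transition c c has_derivative (\<lambda>v. v)) (at (snd c p))"
    by (rule has_derivative_transform_within_open[OF _ chart_image_open[OF c(1)]])
       (use c in \<open>auto simp: transition_apply\<close>)
  then have "jacobian c c p = (\<lambda>v. v)"
    using transition_has_derivative[OF c(1) c(1) c(2) c(2)] has_derivative_unique by blast
  then show ?thesis by simp
qed

text \<open>
  On the common overlap of the three charts the transitions compose, and the chain rule differentiates
  this identity.
\<close>

lemma jacobian_cocycle:
  assumes c: "c \<in> atlas M" "c' \<in> atlas M" "c'' \<in> atlas M" and p: "p \<in> fst c" "p \<in> fst c'" "p \<in> fst c''"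
  shows "jacobian c' c'' p (jacobian c c' p v) = jacobian c c'' p v"
proof -
  let ?W = "snd c ` (fst c \<inter> fst c' \<inter> fst c'')"
  have "open ?W" using c by (intro chart_image_of_open open_Int chart_domain_open) auto
  have "(transition c' c'' \<circ> transition c c' has_derivative jacobian c' c'' p \<circ> jacobian c c' p) (at (snd c p))"
    using diff_chain_at[OF transition_has_derivative[OF c(1,2) p(1,2)],
        of "transition c' c''" "jacobian c' c'' p"]
      transition_has_derivative[OF c(2,3) p(2,3)] transition_apply[OF c(1) p(1)] by simp
  then have "(transition c c'' has_derivative jacobian c' c'' p \<circ> jacobian c c' p) (at (snd c p))"
    by (rule has_derivative_transform_within_open[OF _ \<open>open ?W\<close>])
       (use c p in \<open>auto simp: transition_apply\<close>)
  then have "jacobian c' c'' p \<circ> jacobian c c' p = jacobian c c'' p"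
    using transition_has_derivative[OF c(1,3) p(1,3)] has_derivative_unique by blast
  then show ?thesis by (simp add: fun_eq_iff)
qed

lemma coord_vec_apply:
  "c' \<in> atlas M \<Longrightarrow> p \<in> fst c' \<Longrightarrow> coord_vec M c p v c' = jacobian c c' p v"
  by (simp add: coord_vec_def jacobian_def)

text \<open>
  The compatibility condition between two charts is the cocycle identity of the Jacobians.
\<close>

lemma coord_vec_tangent:
  assumes "c \<in> atlas M" "p \<in> fst c"
  shows "coord_vec M c p v \<in> tangent_space M p"
  unfolding tangent_space_def jacobian_def[symmetric]
  using assms by (auto simp: coord_vec_apply jacobian_cocycle) (auto simp: coord_vec_def)

lemma coord_vec_combination:
  assumes "c \<in> atlas M" "p \<in> fst c"
  shows "coord_vec M c p (a *\<^sub>R u + b *\<^sub>R v) = (\<lambda>c'. a *\<^sub>R coord_vec M c p u c' + b *\<^sub>R coord_vec M c p v c')"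
proof
  fix c'
  show "coord_vec M c p (a *\<^sub>R u + b *\<^sub>R v) c' = a *\<^sub>R coord_vec M c p u c' + b *\<^sub>R coord_vec M c p v c'"
  proof (cases "c' \<in> atlas M \<and> p \<in> fst c'")
    case True
    then have "linear (jacobian c c' p)" using assms linear_jacobian by blast
    then show ?thesis using True by (simp add: coord_vec_apply linear_add linear_cmul)
  next
    case False
    then show ?thesis by (auto simp: coord_vec_def)
  qed
qed

section \<open>The metric in a chart\<close>

lemma chart_metric_combination:
  assumes "c \<in> atlas M" "x \<in> snd c ` fst c"
  shows "chart_metric M c x (a *\<^sub>R u + b *\<^sub>R v) w = a * chart_metric M c x u w + b * chart_metric M c x v w"
  using assms chart_inv_in[OF assms]
  by (simp add: chart_metric_def coord_vec_combination metric_linear coord_vec_tangent)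

lemma chart_metric_sym:
  assumes "c \<in> atlas M" "x \<in> snd c ` fst c"
  shows "chart_metric M c x u v = chart_metric M c x v u"
  using assms chart_inv_in[OF assms] by (simp add: chart_metric_def metric_sym coord_vec_tangent)

lemma linear_chart_metric:
  assumes "c \<in> atlas M" "x \<in> snd c ` fst c"
  shows "linear (\<lambda>u. chart_metric M c x u v)" "linear (chart_metric M c x u)"
proof -
  show "linear (\<lambda>u. chart_metric M c x u v)" for v
  proof (rule linearI)
    show "chart_metric M c x (a + b) v = chart_metric M c x a v + chart_metric M c x b v" for a b
      using chart_metric_combination[OF assms, of 1 a 1 b v] by simp
    show "chart_metric M c x (r *\<^sub>R b) v = r *\<^sub>R chart_metric M c x b v" for r b
      using chart_metric_combination[OF assms, of r b 0 b v] by simp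
  qed
  moreover have "chart_metric M c x u = (\<lambda>v. chart_metric M c x v u)"
    by (rule ext) (rule chart_metric_sym[OF assms])
  ultimately show "linear (chart_metric M c x u)" by metis
qed

text \<open>
  The vector with coordinates \<open>u \<noteq> 0\<close> is nonzero because its component in the chart \<open>c\<close> itself is \<open>u\<close>.
\<close>

lemma chart_metric_pos:
  assumes "c \<in> atlas M" "x \<in> snd c ` fst c" "u \<noteq> 0"
  shows "chart_metric M c x u u > 0"
proof -
  have p: "chart_inv c x \<in> fst c" using chart_inv_in assms by blast
  have "coord_vec M c (chart_inv c x) u c = u"
    using assms p by (simp add: coord_vec_apply jacobian_self)
  then have "coord_vec M c (chart_inv c x) u \<noteq> (\<lambda>c. 0)" using assms(3) by metis
  then show ?thesis
    unfolding chart_metric_def using assms p by (intro metric_pos coord_vec_tangent)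
qed

lemma chart_metric_has_derivative:
  assumes "c \<in> atlas M" "x \<in> snd c ` fst c"
  shows "((\<lambda>y. chart_metric M c y v w) has_derivative (\<lambda>u. chart_metric_deriv M c x u v w)) (at x)"
  using smooth_on_differentiable[OF metric_smooth[OF assms(1)] assms(2)]
  by (simp add: chart_metric_deriv_def frechet_derivative_works)

lemma chart_metric_deriv_sym:
  assumes "c \<in> atlas M" "x \<in> snd c ` fst c"
  shows "chart_metric_deriv M c x u v w = chart_metric_deriv M c x u w v"
proof -
  have "((\<lambda>y. chart_metric M c y w v) has_derivative (\<lambda>u. chart_metric_deriv M c x u v w)) (at x)"
    by (rule has_derivative_transform_within_open[OF chart_metric_has_derivative[OF assms, of v w]
          chart_image_open[OF assms(1)] assms(2)]) (rule chart_metric_sym[OF assms(1)])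
  then have "(\<lambda>u. chart_metric_deriv M c x u v w) = (\<lambda>u. chart_metric_deriv M c x u w v)"
    using chart_metric_has_derivative[OF assms, of w v] has_derivative_unique by blast
  then show ?thesis by metis
qed

text \<open>
  Bilinearity of the metric holds at all points of the open chart image, so it can be differentiated.
\<close>

lemma chart_metric_deriv_combination:
  assumes "c \<in> atlas M" "x \<in> snd c ` fst c"
  shows "chart_metric_deriv M c x u (a *\<^sub>R v + b *\<^sub>R v') w =
    a * chart_metric_deriv M c x u v w + b * chart_metric_deriv M c x u v' w"
proof -
  have "((\<lambda>y. a * chart_metric M c y v w + b * chart_metric M c y v' w) has_derivative
      (\<lambda>u. a * chart_metric_deriv M c x u v w + b * chart_metric_deriv M c x u v' w)) (at x)"
    by (intro has_derivative_add has_derivative_mult_right chart_metric_has_derivative assms)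
  then have "((\<lambda>y. chart_metric M c y (a *\<^sub>R v + b *\<^sub>R v') w) has_derivative
      (\<lambda>u. a * chart_metric_deriv M c x u v w + b * chart_metric_deriv M c x u v' w)) (at x)"
    by (rule has_derivative_transform_within_open[OF _ chart_image_open[OF assms(1)] assms(2)])
       (simp add: chart_metric_combination[OF assms(1)])
  then have "(\<lambda>u. a * chart_metric_deriv M c x u v w + b * chart_metric_deriv M c x u v' w) =
      (\<lambda>u. chart_metric_deriv M c x u (a *\<^sub>R v + b *\<^sub>R v') w)"
    using chart_metric_has_derivative[OF assms] has_derivative_unique by blast
  then show ?thesis by metis
qed

lemma linear_chart_metric_deriv:
  assumes "c \<in> atlas M" "x \<in> snd c ` fst c"
  shows "linear (\<lambda>u. chart_metric_deriv M c x u v w)" "linear (\<lambda>v. chart_metric_deriv M c x u v w)"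
    "linear (\<lambda>w. chart_metric_deriv M c x u v w)"
proof -
  show "linear (\<lambda>u. chart_metric_deriv M c x u v w)"
    using chart_metric_has_derivative[OF assms] by (rule has_derivative_linear)
  show 2: "linear (\<lambda>v. chart_metric_deriv M c x u v w)" for w
  proof (rule linearI)
    show "chart_metric_deriv M c x u (a + b) w = chart_metric_deriv M c x u a w + chart_metric_deriv M c x u b w" for a b
      using chart_metric_deriv_combination[OF assms, of u 1 a 1 b w] by simp
    show "chart_metric_deriv M c x u (r *\<^sub>R b) w = r *\<^sub>R chart_metric_deriv M c x u b w" for r b
      using chart_metric_deriv_combination[OF assms, of u r b 0 b w] by simp
  qed
  show "linear (\<lambda>w. chart_metric_deriv M c x u v w)"
    unfolding chart_metric_deriv_sym[OF assms, of u v] by (rule 2)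
qed

lemma linear_christoffel:
  assumes "c \<in> atlas M" "x \<in> snd c ` fst c"
  shows "linear (\<lambda>u. christoffel M c x u v w)" "linear (\<lambda>v. christoffel M c x u v w)"
    "linear (christoffel M c x u v)"
  unfolding christoffel_eq[abs_def]
  by (rule linearI; simp add: linear_add[OF linear_chart_metric_deriv(1)[OF assms]]
      linear_add[OF linear_chart_metric_deriv(2)[OF assms]] linear_add[OF linear_chart_metric_deriv(3)[OF assms]]
      linear_cmul[OF linear_chart_metric_deriv(1)[OF assms]] linear_cmul[OF linear_chart_metric_deriv(2)[OF assms]]
      linear_cmul[OF linear_chart_metric_deriv(3)[OF assms]] field_simps)+

lemma lipschitz_near_chart_metric:
  assumes "orthonormal_frame (B :: 'e set)" "c \<in> atlas M" "x \<in> snd c ` fst c"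
  shows "lipschitz_near x (\<lambda>y. chart_metric M c y u v)"
  by (rule smooth_on_lipschitz_near[OF assms(1) chart_image_open[OF assms(2)] assms(3) metric_smooth[OF assms(2)]])

lemma lipschitz_near_christoffel:
  assumes B: "orthonormal_frame (B :: 'e set)" "c \<in> atlas M" "x \<in> snd c ` fst c"
  shows "lipschitz_near x (\<lambda>y. christoffel M c y u v w)"
proof -
  have T: "lipschitz_near x (\<lambda>y. chart_metric_deriv M c y u v w)" for u v w
    unfolding chart_metric_deriv_def
    by (rule smooth_on_lipschitz_near[OF assms(1) chart_image_open[OF assms(2)] assms(3)
          smooth_on_directional_derivative[OF metric_smooth[OF assms(2)]]])
  have "christoffel M c y u v w = 1 / 2 * (chart_metric_deriv M c y u v w +
      (chart_metric_deriv M c y v u w + (- 1) * chart_metric_deriv M c y w u v))" for y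
    by (simp add: christoffel_eq)
  then show ?thesis by (simp only:) (intro lipschitz_near_add lipschitz_near_cmult T)
qed

section \<open>Curves\<close>

text \<open>
  Continuity is part of the definition because differentiability in charts says something only about
  charts around the point itself: without it the curve might leave the chart domain at nearby times.
\<close>

definition curve_differentiable_at :: "(real \<Rightarrow> 'm) \<Rightarrow> real \<Rightarrow> bool" where
  "curve_differentiable_at \<gamma> t \<longleftrightarrow>
     isCont \<gamma> t \<and> (\<forall>c\<in>atlas M. \<gamma> t \<in> fst c \<longrightarrow> (snd c \<circ> \<gamma>) differentiable (at t))"

lemma velocity_apply:
  "c \<in> atlas M \<Longrightarrow> \<gamma> t \<in> fst c \<Longrightarrow> velocity M \<gamma> t c = vector_derivative (snd c \<circ> \<gamma>) (at t)"
  by (simp add: velocity_def)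

text \<open>
  The chain rule for \<open>snd c' \<circ> \<gamma> = transition c c' \<circ> (snd c \<circ> \<gamma>)\<close>, an identity that continuity of \<open>\<gamma>\<close>
  guarantees near \<open>t\<close>.
\<close>

lemma velocity_eq_coord_vec:
  assumes \<gamma>: "curve_differentiable_at \<gamma> t" and c: "c \<in> atlas M" "\<gamma> t \<in> fst c"
  shows "velocity M \<gamma> t = coord_vec M c (\<gamma> t) (vector_derivative (snd c \<circ> \<gamma>) (at t))"
proof
  fix c'
  show "velocity M \<gamma> t c' = coord_vec M c (\<gamma> t) (vector_derivative (snd c \<circ> \<gamma>) (at t)) c'"
  proof (cases "c' \<in> atlas M \<and> \<gamma> t \<in> fst c'")
    case True
    have "eventually (\<lambda>s. \<gamma> s \<in> fst c) (nhds t)"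
      using \<gamma> c chart_domain_open by (intro isCont_eventually_in_open) (auto simp: curve_differentiable_at_def)
    then obtain S where S: "open S" "t \<in> S" "\<And>s. s \<in> S \<Longrightarrow> \<gamma> s \<in> fst c"
      unfolding eventually_nhds by blast
    have "((snd c \<circ> \<gamma>) has_vector_derivative vector_derivative (snd c \<circ> \<gamma>) (at t)) (at t)"
      using \<gamma> c by (simp add: curve_differentiable_at_def vector_derivative_works)
    moreover have "(transition c c' has_derivative jacobian c c' (\<gamma> t)) (at ((snd c \<circ> \<gamma>) t))"
      using transition_has_derivative[of c c' "\<gamma> t"] True c by simp
    ultimately have "((transition c c' \<circ> (snd c \<circ> \<gamma>)) has_vector_derivative
        jacobian c c' (\<gamma> t) (vector_derivative (snd c \<circ> \<gamma>) (at t))) (at t)"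
      by (rule vector_derivative_diff_chain_within[OF _ has_derivative_at_withinI])
    then have "((snd c' \<circ> \<gamma>) has_vector_derivative
        jacobian c c' (\<gamma> t) (vector_derivative (snd c \<circ> \<gamma>) (at t))) (at t)"
      by (rule has_vector_derivative_transform_within_open[OF _ S(1,2)])
         (use S(3) c in \<open>auto simp: transition_apply\<close>)
    then show ?thesis using True by (simp add: velocity_apply coord_vec_apply vector_derivative_at)
  next
    case False
    then show ?thesis by (auto simp: velocity_def coord_vec_def)
  qed
qed

lemma velocity_tangent:
  assumes "curve_differentiable_at \<gamma> t"
  shows "velocity M \<gamma> t \<in> tangent_space M (\<gamma> t)"
proof -
  obtain c where "c \<in> atlas M" "\<gamma> t \<in> fst c" by (rule chart_at)
  then show ?thesis using velocity_eq_coord_vec[OF assms] coord_vec_tangent by simp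
qed

lemma velocity_cong:
  assumes "open S" "t \<in> S" "\<And>s. s \<in> S \<Longrightarrow> \<gamma> s = \<eta> s"
  shows "velocity M \<gamma> t = velocity M \<eta> t"
proof -
  have eq: "vector_derivative (snd c \<circ> \<gamma>) (at t) = vector_derivative (snd c \<circ> \<eta>) (at t)" for c :: "('m, 'e) chart"
    by (rule vector_derivative_cong_open[OF assms(1,2)]) (simp add: assms(3))
  show ?thesis unfolding velocity_def eq assms(3)[OF assms(2)] ..
qed

text \<open>
  Both continuity and differentiability in charts depend only on the germ of the curve.
\<close>

lemma curve_differentiable_at_cong:
  assumes "open S" "t \<in> S" "\<And>s. s \<in> S \<Longrightarrow> \<gamma> s = \<eta> s" "curve_differentiable_at \<gamma> t"
  shows "curve_differentiable_at \<eta> t"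
proof -
  have ev: "eventually (\<lambda>s. \<gamma> s = \<eta> s) (nhds t)"
    using eventually_nhds_in_open[OF assms(1,2)] by eventually_elim (rule assms(3))
  have "(snd c \<circ> \<eta>) differentiable (at t)" if diff: "(snd c \<circ> \<gamma>) differentiable (at t)" for c :: "('m, 'e) chart"
  proof -
    have "((snd c \<circ> \<gamma>) has_vector_derivative vector_derivative (snd c \<circ> \<gamma>) (at t)) (at t)"
      using diff by (simp add: vector_derivative_works)
    then have "((snd c \<circ> \<eta>) has_vector_derivative vector_derivative (snd c \<circ> \<gamma>) (at t)) (at t)"
      by (rule has_vector_derivative_transform_within_open[OF _ assms(1,2)]) (simp add: assms(3))
    then show ?thesis by (rule differentiableI_vector)
  qed
  then show ?thesis
    using assms(4) isCont_cong[OF ev] assms(2,3) unfolding curve_differentiable_at_def by metis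
qed

lemma open_chart_times:
  assumes "continuous_on J \<gamma>" "open J" "c \<in> atlas M"
  shows "open {t \<in> J. \<gamma> t \<in> fst c}"
proof -
  have "open (J \<inter> \<gamma> -` fst c)"
    using assms chart_domain_open by (intro continuous_open_preimage) auto
  moreover have "J \<inter> \<gamma> -` fst c = {t \<in> J. \<gamma> t \<in> fst c}" by auto
  ultimately show ?thesis by simp
qed

lemma smooth_curve_differentiable_at:
  assumes "smooth_curve_on M J \<gamma>" "open J" "t \<in> J"
  shows "curve_differentiable_at \<gamma> t"
  unfolding curve_differentiable_at_def
proof (intro conjI ballI impI)
  show "isCont \<gamma> t"
    using assms by (simp add: smooth_curve_on_def continuous_on_eq_continuous_at)
  fix c assume "c \<in> atlas M" "\<gamma> t \<in> fst c"
  then show "(snd c \<circ> \<gamma>) differentiable (at t)"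
    using assms by (intro smooth_on_differentiable[of "{t \<in> J. \<gamma> t \<in> fst c}"]) (auto simp: smooth_curve_on_def)
qed

section \<open>Geodesics\<close>

lemma geodesic_in_chart:
  assumes J: "open J" and \<gamma>: "geodesic_on M J \<gamma>" and c: "c \<in> atlas M" and t: "t \<in> J" "\<gamma> t \<in> fst c"
    and \<sigma>_def: "\<sigma> = snd c \<circ> \<gamma>" and \<sigma>'_def: "\<sigma>' = (\<lambda>s. vector_derivative \<sigma> (at s))"
    and \<sigma>''_def: "\<sigma>'' = (\<lambda>s. vector_derivative \<sigma>' (at s))"
  shows "(\<sigma> has_vector_derivative \<sigma>' t) (at t)" "(\<sigma>' has_vector_derivative \<sigma>'' t) (at t)" "isCont \<sigma>'' t"
    "chart_metric M c (\<sigma> t) (\<sigma>'' t) w + christoffel M c (\<sigma> t) (\<sigma>' t) (\<sigma>' t) w = 0"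
proof -
  let ?W = "{t \<in> J. \<gamma> t \<in> fst c}"
  have W: "open ?W" using \<gamma> J c by (intro open_chart_times) (auto simp: geodesic_on_def smooth_curve_on_def)
  have tW: "t \<in> ?W" using t by simp
  have 0: "smooth_on ?W \<sigma>" using \<gamma> c by (simp add: geodesic_on_def smooth_curve_on_def \<sigma>_def)
  have 1: "smooth_on ?W \<sigma>'" unfolding \<sigma>'_def by (rule smooth_on_vector_derivative[OF 0 W])
  have 2: "smooth_on ?W \<sigma>''" unfolding \<sigma>''_def by (rule smooth_on_vector_derivative[OF 1 W])
  show "(\<sigma> has_vector_derivative \<sigma>' t) (at t)"
    unfolding \<sigma>'_def by (rule smooth_on_has_vector_derivative[OF 0 tW])
  show "(\<sigma>' has_vector_derivative \<sigma>'' t) (at t)"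
    unfolding \<sigma>''_def by (rule smooth_on_has_vector_derivative[OF 1 tW])
  show "isCont \<sigma>'' t"
    using smooth_on_continuous[OF 2] W tW by (simp add: continuous_on_eq_continuous_at)
  show "chart_metric M c (\<sigma> t) (\<sigma>'' t) w + christoffel M c (\<sigma> t) (\<sigma>' t) (\<sigma>' t) w = 0"
    using \<gamma> c t unfolding geodesic_on_def Let_def \<sigma>''_def \<sigma>'_def \<sigma>_def by blast
qed

lemma geodesic_curve_differentiable_at:
  "geodesic_on M J \<gamma> \<Longrightarrow> open J \<Longrightarrow> t \<in> J \<Longrightarrow> curve_differentiable_at \<gamma> t"
  by (auto simp: geodesic_on_def intro: smooth_curve_differentiable_at)

lemma frame_exists: "\<exists>B :: 'e set. orthonormal_frame B"
  using finite_dimensional orthonormal_frame_exists by blast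

text \<open>
  Both geodesics are read in one chart around their common point.  On a small time interval they stay
  in the ball of the Lipschitz estimate, with velocities and one acceleration bounded by \<open>N\<close>, so the
  uniqueness theorem for second-order equations applies to their coordinate representations.
\<close>

lemma geodesic_local_uniqueness:
  assumes J: "open J" "open J'" and geo: "geodesic_on M J \<gamma>" "geodesic_on M J' \<eta>"
    and t0: "t0 \<in> J" "t0 \<in> J'" and init: "\<gamma> t0 = \<eta> t0" "velocity M \<gamma> t0 = velocity M \<eta> t0"
  shows "\<exists>e>0. \<forall>s. \<bar>s - t0\<bar> < e \<longrightarrow> \<gamma> s = \<eta> s"
proof -
  obtain c where c: "c \<in> atlas M" "\<gamma> t0 \<in> fst c" by (rule chart_at)
  obtain B :: "'e set" where B: "orthonormal_frame B" using frame_exists by blast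
  define x where "x = snd c \<circ> \<gamma>"
  define x' where "x' = (\<lambda>s. vector_derivative x (at s))"
  define x'' where "x'' = (\<lambda>s. vector_derivative x' (at s))"
  define y where "y = snd c \<circ> \<eta>"
  define y' where "y' = (\<lambda>s. vector_derivative y (at s))"
  define y'' where "y'' = (\<lambda>s. vector_derivative y' (at s))"
  let ?V = "snd c ` fst c"
  have V: "open ?V" "x t0 \<in> ?V" using c chart_image_open by (auto simp: x_def)
  note gx = geodesic_in_chart[OF J(1) geo(1) c(1) _ _ x_def x'_def x''_def]
  note gy = geodesic_in_chart[OF J(2) geo(2) c(1) _ _ y_def y'_def y''_def]
  have c': "\<eta> t0 \<in> fst c" using c init by simp
  \<comment> \<open>the summand \<open>1\<close> makes the bounds strict at \<open>t0\<close>, hence valid nearby by continuity\<close>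
  define N where "N = norm (x' t0) + norm (y' t0) + norm (y'' t0) + 1"
  have N: "N \<ge> 0" "norm (x' t0) < N" "norm (y' t0) < N" "norm (y'' t0) < N"
    using norm_ge_zero[of "x' t0"] norm_ge_zero[of "y' t0"] norm_ge_zero[of "y'' t0"]
    unfolding N_def by linarith+
  obtain r L where r: "r > 0" and L: "L \<ge> 0" and lip: "\<And>p q v v' a a'. p \<in> ball (x t0) r \<Longrightarrow> q \<in> ball (x t0) r \<Longrightarrow>
      norm v \<le> N \<and> norm v' \<le> N \<and> norm a' \<le> N \<and>
      (\<forall>w. chart_metric M c p a w + christoffel M c p v v w = 0) \<and>
      (\<forall>w. chart_metric M c q a' w + christoffel M c q v' v' w = 0) \<Longrightarrow>
      norm (a - a') \<le> L * (norm (p - q) + norm (v - v'))"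
    using implicit_quadratic_equation_lipschitz[OF B V, of "chart_metric M c" "christoffel M c" N,
      OF linear_chart_metric[OF c(1)] linear_christoffel[OF c(1)] lipschitz_near_chart_metric[OF B c(1) V(2)]
      lipschitz_near_christoffel[OF B c(1) V(2)] chart_metric_pos[OF c(1) V(2)] N(1)] by blast
  have contx: "isCont x t0" "isCont x' t0"
    using has_vector_derivative_continuous[OF gx(1)[OF t0(1) c(2)]]
      has_vector_derivative_continuous[OF gx(2)[OF t0(1) c(2)]] by auto
  have conty: "isCont y t0" "isCont y' t0" "isCont y'' t0"
    using has_vector_derivative_continuous[OF gy(1)[OF t0(2) c']]
      has_vector_derivative_continuous[OF gy(2)[OF t0(2) c']] gy(3)[OF t0(2) c'] by auto
  have init': "x t0 = y t0" "x' t0 = y' t0"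
    using init c c' velocity_apply[of c \<gamma> t0] velocity_apply[of c \<eta> t0]
    by (auto simp: x_def y_def x'_def y'_def)
  have cont\<gamma>: "isCont \<gamma> t0" "isCont \<eta> t0"
    using geodesic_curve_differentiable_at[OF geo(1) J(1) t0(1)] geodesic_curve_differentiable_at[OF geo(2) J(2) t0(2)]
    by (auto simp: curve_differentiable_at_def)
  have "eventually (\<lambda>s. s \<in> J \<and> s \<in> J' \<and> \<gamma> s \<in> fst c \<and> \<eta> s \<in> fst c \<and> x s \<in> ball (x t0) r \<and> y s \<in> ball (x t0) r
      \<and> x' s \<in> ball 0 N \<and> y' s \<in> ball 0 N \<and> y'' s \<in> ball 0 N) (nhds t0)"
    using J t0 c c' r N init' chart_domain_open[OF c(1)]
    by (intro eventually_conj eventually_nhds_in_open isCont_eventually_in_open cont\<gamma> contx conty open_ball) auto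
  then obtain e where e: "e > 0" and E: "\<And>s. dist s t0 < e \<Longrightarrow> s \<in> J \<and> s \<in> J' \<and> \<gamma> s \<in> fst c \<and> \<eta> s \<in> fst c
      \<and> x s \<in> ball (x t0) r \<and> y s \<in> ball (x t0) r \<and> x' s \<in> ball 0 N \<and> y' s \<in> ball 0 N \<and> y'' s \<in> ball 0 N"
    unfolding eventually_nhds_metric by blast
  have E: "s \<in> J" "s \<in> J'" "\<gamma> s \<in> fst c" "\<eta> s \<in> fst c" "x s \<in> ball (x t0) r" "y s \<in> ball (x t0) r"
    "norm (x' s) \<le> N" "norm (y' s) \<le> N" "norm (y'' s) \<le> N" if "\<bar>s - t0\<bar> < e" for s
    using E[of s] that by (auto simp: dist_real_def)
  have "\<gamma> s = \<eta> s" if s: "\<bar>s - t0\<bar> < e" for s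
  proof -
    have "x s = y s"
    proof (rule second_order_uniqueness[where ?t0.0 = t0 and e = e and L = L and x = x and y = y and t = s and x' = x' and y' = y' and x'' = x'' and y'' = y'', OF _ _ _ _ _ L init'(1) init'(2) s])
      fix t assume t: "\<bar>t - t0\<bar> < e"
      note E = E[OF t]
      show "(x has_vector_derivative x' t) (at t)" "(x' has_vector_derivative x'' t) (at t)"
        using gx(1)[OF E(1,3)] gx(2)[OF E(1,3)] by blast+
      show "(y has_vector_derivative y' t) (at t)" "(y' has_vector_derivative y'' t) (at t)"
        using gy(1)[OF E(2,4)] gy(2)[OF E(2,4)] by blast+
      show "norm (x'' t - y'' t) \<le> L * (norm (x t - y t) + norm (x' t - y' t))"
        by (rule lip[OF E(5,6)], intro conjI allI E(7) E(8) E(9) gx(4)[OF E(1,3)] gy(4)[OF E(2,4)])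
    qed
    then have "snd c (\<gamma> s) = snd c (\<eta> s)" by (simp add: x_def y_def)
    then have "chart_inv c (snd c (\<gamma> s)) = chart_inv c (snd c (\<eta> s))" by (rule arg_cong)
    then show ?thesis
      unfolding chart_inv_left[OF c(1) E(3)[OF s]] chart_inv_left[OF c(1) E(4)[OF s]] .
  qed
  then show ?thesis using e by blast
qed

lemma geodesics_with_same_data_open:
  assumes J: "open J" "open J'" and geo: "geodesic_on M J \<gamma>" "geodesic_on M J' \<eta>"
    and t: "t \<in> J" "t \<in> J'" and init: "\<gamma> t = \<eta> t" "velocity M \<gamma> t = velocity M \<eta> t"
  shows "\<exists>e>0. \<forall>s\<in>ball t e. \<gamma> s = \<eta> s \<and> velocity M \<gamma> s = velocity M \<eta> s"
proof -
  obtain e where e: "e > 0" "\<And>s. \<bar>s - t\<bar> < e \<Longrightarrow> \<gamma> s = \<eta> s"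
    using geodesic_local_uniqueness[OF J geo t init] by blast
  then have eq: "\<gamma> s = \<eta> s" if "s \<in> ball t e" for s
    using that by (simp add: dist_real_def abs_minus_commute)
  have "velocity M \<gamma> s = velocity M \<eta> s" if "s \<in> ball t e" for s
    by (rule velocity_cong[OF open_ball that eq])
  with eq e(1) show ?thesis by blast
qed

text \<open>
  If the points differ, the Hausdorff property and continuity keep them apart.  If only the velocities
  differ, they do so in some chart around the common point, where both are continuous in time.
\<close>

lemma geodesics_with_different_data_open:
  assumes J: "open J" "open J'" and geo: "geodesic_on M J \<gamma>" "geodesic_on M J' \<eta>"
    and t: "t \<in> J" "t \<in> J'" and differ: "\<not> (\<gamma> t = \<eta> t \<and> velocity M \<gamma> t = velocity M \<eta> t)"
  shows "\<exists>e>0. \<forall>s\<in>ball t e. \<not> (\<gamma> s = \<eta> s \<and> velocity M \<gamma> s = velocity M \<eta> s)"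
proof -
  have cont: "isCont \<gamma> t" "isCont \<eta> t"
    using geodesic_curve_differentiable_at[OF geo(1) J(1) t(1)] geodesic_curve_differentiable_at[OF geo(2) J(2) t(2)]
    by (auto simp: curve_differentiable_at_def)
  have "eventually (\<lambda>s. \<not> (\<gamma> s = \<eta> s \<and> velocity M \<gamma> s = velocity M \<eta> s)) (nhds t)"
  proof (cases "\<gamma> t = \<eta> t")
    case False
    then obtain U V where UV: "open U" "open V" "\<gamma> t \<in> U" "\<eta> t \<in> V" "U \<inter> V = {}"
      using hausdorff by metis
    show ?thesis
      using isCont_eventually_in_open[OF cont(1) UV(1,3)] isCont_eventually_in_open[OF cont(2) UV(2,4)]
      by eventually_elim (use UV(5) in auto)
  next
    case True
    with differ obtain c where c: "velocity M \<gamma> t c \<noteq> velocity M \<eta> t c" by blast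
    then have c': "c \<in> atlas M" "\<gamma> t \<in> fst c" "\<eta> t \<in> fst c"
      using True by (auto simp: velocity_def split: if_splits)
    define x' where "x' = (\<lambda>s. vector_derivative (snd c \<circ> \<gamma>) (at s))"
    define y' where "y' = (\<lambda>s. vector_derivative (snd c \<circ> \<eta>) (at s))"
    have "isCont x' t"
      using has_vector_derivative_continuous[OF geodesic_in_chart(2)[OF J(1) geo(1) c'(1) t(1) c'(2) refl refl refl]]
      by (simp add: x'_def)
    moreover have "isCont y' t"
      using has_vector_derivative_continuous[OF geodesic_in_chart(2)[OF J(2) geo(2) c'(1) t(2) c'(3) refl refl refl]]
      by (simp add: y'_def)
    ultimately have "isCont (\<lambda>s. x' s - y' s) t" by (rule continuous_diff)
    moreover have "open (- {0 :: 'e})" by (intro open_Compl closed_singleton)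
    moreover have "x' t - y' t \<in> - {0}"
      using c c' by (simp add: velocity_def x'_def y'_def)
    ultimately have "eventually (\<lambda>s. x' s - y' s \<in> - {0}) (nhds t)"
      by (rule isCont_eventually_in_open)
    then show ?thesis
      using isCont_eventually_in_open[OF cont(1) chart_domain_open[OF c'(1)] c'(2)]
        isCont_eventually_in_open[OF cont(2) chart_domain_open[OF c'(1)] c'(3)]
    proof eventually_elim
      fix s assume s: "x' s - y' s \<in> - {0}" "\<gamma> s \<in> fst c" "\<eta> s \<in> fst c"
      then have "velocity M \<gamma> s c \<noteq> velocity M \<eta> s c"
        using c'(1) by (simp add: velocity_def x'_def y'_def)
      then show "\<not> (\<gamma> s = \<eta> s \<and> velocity M \<gamma> s = velocity M \<eta> s)" by metis
    qed
  qed
  then show ?thesis unfolding eventually_nhds_metric by (simp add: dist_commute Ball_def)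
qed

text \<open>
  The times in \<open>{0..1}\<close> at which points and velocities agree form a set that is both open and closed and
  contains \<open>0\<close>.
\<close>

lemma geodesic_uniqueness:
  assumes J: "open J" "{0..1} \<subseteq> J" "open J'" "{0..1} \<subseteq> J'"
    and geo: "geodesic_on M J \<gamma>" "geodesic_on M J' \<eta>"
    and init: "\<gamma> 0 = \<eta> 0" "velocity M \<gamma> 0 = velocity M \<eta> 0"
  shows "\<gamma> 1 = \<eta> 1"
proof -
  let ?P = "\<lambda>t. \<gamma> t = \<eta> t \<and> velocity M \<gamma> t = velocity M \<eta> t"
  let ?E = "{t \<in> {0..1}. ?P t}"
  have "openin (top_of_set {0..1}) ?E"
    unfolding openin_contains_ball
  proof (intro conjI ballI)
    fix t assume t: "t \<in> ?E"
    then obtain e where e: "e > 0" "\<forall>s\<in>ball t e. ?P s"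
      using geodesics_with_same_data_open[OF J(1,3) geo, of t] J(2,4) by blast
    then show "\<exists>e>0. ball t e \<inter> {0..1} \<subseteq> ?E" by blast
  qed auto
  moreover have "openin (top_of_set {0..1}) ({0..1} - ?E)"
    unfolding openin_contains_ball
  proof (intro conjI ballI)
    fix t assume t: "t \<in> {0..1} - ?E"
    then obtain e where e: "e > 0" "\<forall>s\<in>ball t e. \<not> ?P s"
      using geodesics_with_different_data_open[OF J(1,3) geo, of t] J(2,4) by blast
    then show "\<exists>e>0. ball t e \<inter> {0..1} \<subseteq> {0..1} - ?E" by blast
  qed auto
  moreover have "?E \<subseteq> {0..1}" by blast
  ultimately have "openin (top_of_set {0..1}) ?E \<and> closedin (top_of_set {0..1}) ?E"
    unfolding closedin_def topspace_euclidean_subtopology by (intro conjI)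
  with connected_Icc[of "0::real" 1] have "?E = {} \<or> ?E = {0..1}"
    unfolding connected_clopen by (elim allE impE)
  moreover have "0 \<in> ?E" using init by simp
  ultimately have "?E = {0..1}" by blast
  then have "1 \<in> ?E" by simp
  then show ?thesis by simp
qed

text \<open>
  Uniqueness of geodesics makes the end point independent of the chosen geodesic, as the definite
  description in the exponential map requires.
\<close>

lemma exp_map_velocity:
  assumes "geodesic_between M p q \<gamma>"
  shows "exp_map M p (velocity M \<gamma> 0) = q"
  unfolding exp_map_def
proof (rule the_equality)
  show "\<exists>\<eta>. geodesic_between M p q \<eta> \<and> velocity M \<eta> 0 = velocity M \<gamma> 0" using assms by blast
next
  fix q' assume "\<exists>\<eta>. geodesic_between M p q' \<eta> \<and> velocity M \<eta> 0 = velocity M \<gamma> 0"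
  then obtain \<eta> where \<eta>: "geodesic_between M p q' \<eta>" "velocity M \<eta> 0 = velocity M \<gamma> 0" by blast
  then obtain J J' where "open J" "{0..1} \<subseteq> J" "geodesic_on M J \<gamma>" "open J'" "{0..1} \<subseteq> J'" "geodesic_on M J' \<eta>"
    using assms unfolding geodesic_between_def by blast
  from geodesic_uniqueness[OF this(4,5,1,2,6,3) _ \<eta>(2)] show "q' = q"
    using assms \<eta>(1) by (simp add: geodesic_between_def)
qed

text \<open>
  Differentiating \<open>g(\<sigma>', \<sigma>')\<close> gives \<open>2 g(\<sigma>'', \<sigma>') + (D\<^sub>u g)(\<sigma>', \<sigma>')\<close> with \<open>u = \<sigma>'\<close>.  The geodesic
  equation tested against \<open>w = \<sigma>'\<close> says that this vanishes, since two of the three terms of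
  \<open>\<Gamma>(\<sigma>', \<sigma>'; \<sigma>')\<close> cancel.
\<close>

lemma chart_metric_along_geodesic_constant:
  assumes J: "open J" and geo: "geodesic_on M J \<gamma>" and c: "c \<in> atlas M" and t: "t \<in> J" "\<gamma> t \<in> fst c"
    and \<sigma>_def: "\<sigma> = snd c \<circ> \<gamma>" and \<sigma>'_def: "\<sigma>' = (\<lambda>s. vector_derivative \<sigma> (at s))"
  shows "((\<lambda>s. chart_metric M c (\<sigma> s) (\<sigma>' s) (\<sigma>' s)) has_real_derivative 0) (at t)"
proof -
  obtain B :: "'e set" where B: "orthonormal_frame B" using frame_exists by blast
  define \<sigma>'' where "\<sigma>'' = (\<lambda>s. vector_derivative \<sigma>' (at s))"
  note g = geodesic_in_chart[OF J geo c t \<sigma>_def \<sigma>'_def \<sigma>''_def]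
  let ?g = "chart_metric M c" and ?T = "chart_metric_deriv M c (\<sigma> t)"
  have x: "\<sigma> t \<in> snd c ` fst c" using t by (simp add: \<sigma>_def)
  have coeff: "((\<lambda>s. ?g (\<sigma> s) i j) has_real_derivative ?T (\<sigma>' t) i j) (at t)" for i j
  proof -
    have "((\<lambda>y. ?g y i j) \<circ> \<sigma> has_vector_derivative ?T (\<sigma>' t) i j) (at t)"
      by (rule vector_derivative_diff_chain_within[OF g(1)
            has_derivative_at_withinI[OF chart_metric_has_derivative[OF c x]]])
    then show ?thesis by (simp add: has_real_derivative_iff_has_vector_derivative o_def)
  qed
  have comp: "((\<lambda>s. \<sigma>' s \<bullet> i) has_real_derivative \<sigma>'' t \<bullet> i) (at t)" for i
    using bounded_linear.has_vector_derivative[OF bounded_linear_inner_left g(2), of i]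
    by (simp add: has_real_derivative_iff_has_vector_derivative)
  \<comment> \<open>the product rule, term by term in the frame expansion\<close>
  let ?D = "(\<Sum>p\<in>B \<times> B. ((\<sigma>'' t \<bullet> fst p) * (\<sigma>' t \<bullet> snd p)) * ?g (\<sigma> t) (fst p) (snd p)
    + ((\<sigma>' t \<bullet> fst p) * (\<sigma>'' t \<bullet> snd p)) * ?g (\<sigma> t) (fst p) (snd p)
    + ((\<sigma>' t \<bullet> fst p) * (\<sigma>' t \<bullet> snd p)) * ?T (\<sigma>' t) (fst p) (snd p))"
  have der: "((\<lambda>s. \<Sum>p\<in>B \<times> B. ((\<sigma>' s \<bullet> fst p) * (\<sigma>' s \<bullet> snd p)) * ?g (\<sigma> s) (fst p) (snd p))
      has_real_derivative ?D) (at t)"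
    by (intro DERIV_sum) (auto intro!: derivative_eq_intros coeff comp simp: algebra_simps)
  have expand: "h a b = (\<Sum>p\<in>B \<times> B. ((a \<bullet> fst p) * (b \<bullet> snd p)) * h (fst p) (snd p))"
    if "\<And>v. linear (\<lambda>u. h u v)" "\<And>u. linear (h u)" for h :: "'e \<Rightarrow> 'e \<Rightarrow> real" and a b
    using bilinear_frame_expansion[OF B that, of a b] by (simp add: case_prod_unfold)
  have "?D = ?g (\<sigma> t) (\<sigma>'' t) (\<sigma>' t) + ?g (\<sigma> t) (\<sigma>' t) (\<sigma>'' t) + ?T (\<sigma>' t) (\<sigma>' t) (\<sigma>' t)"
    using expand[of "?g (\<sigma> t)", OF linear_chart_metric[OF c x], of "\<sigma>'' t" "\<sigma>' t"]
      expand[of "?g (\<sigma> t)", OF linear_chart_metric[OF c x], of "\<sigma>' t" "\<sigma>'' t"]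
      expand[of "?T (\<sigma>' t)", OF linear_chart_metric_deriv(2,3)[OF c x], of "\<sigma>' t" "\<sigma>' t"]
    by (simp add: sum.distrib)
  also have "\<dots> = 0"
    using g(4)[of "\<sigma>' t"] chart_metric_sym[OF c x, of "\<sigma>' t"] by (simp add: christoffel_eq)
  finally have der0: "((\<lambda>s. \<Sum>p\<in>B \<times> B. ((\<sigma>' s \<bullet> fst p) * (\<sigma>' s \<bullet> snd p)) * ?g (\<sigma> s) (fst p) (snd p))
      has_real_derivative 0) (at t)" using der by simp
  have W: "open {t \<in> J. \<gamma> t \<in> fst c}"
    using geo J c by (intro open_chart_times) (auto simp: geodesic_on_def smooth_curve_on_def)
  show ?thesis
  proof (rule has_field_derivative_transform_within_open[OF der0 W])
    fix s assume "s \<in> {t \<in> J. \<gamma> t \<in> fst c}"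
    then have "\<sigma> s \<in> snd c ` fst c" by (simp add: \<sigma>_def)
    from expand[of "?g (\<sigma> s)", OF linear_chart_metric[OF c this], symmetric]
    show "(\<Sum>p\<in>B \<times> B. ((\<sigma>' s \<bullet> fst p) * (\<sigma>' s \<bullet> snd p)) * ?g (\<sigma> s) (fst p) (snd p)) = ?g (\<sigma> s) (\<sigma>' s) (\<sigma>' s)" .
  qed (use t in auto)
qed

lemma geodesic_speed_derivative:
  assumes J: "open J" and geo: "geodesic_on M J \<gamma>" and t: "t \<in> J"
  shows "((\<lambda>s. metric M (\<gamma> s) (velocity M \<gamma> s) (velocity M \<gamma> s)) has_real_derivative 0) (at t)"
proof -
  obtain c where c: "c \<in> atlas M" "\<gamma> t \<in> fst c" by (rule chart_at)
  have W: "open {t \<in> J. \<gamma> t \<in> fst c}"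
    using geo J c by (intro open_chart_times) (auto simp: geodesic_on_def smooth_curve_on_def)
  show ?thesis
  proof (rule has_field_derivative_transform_within_open[OF chart_metric_along_geodesic_constant[OF J geo c(1) t c(2) refl refl] W])
    fix s assume s: "s \<in> {t \<in> J. \<gamma> t \<in> fst c}"
    then have "curve_differentiable_at \<gamma> s" using geodesic_curve_differentiable_at[OF geo J] by simp
    then show "chart_metric M c ((snd c \<circ> \<gamma>) s) (vector_derivative (snd c \<circ> \<gamma>) (at s)) (vector_derivative (snd c \<circ> \<gamma>) (at s)) =
        metric M (\<gamma> s) (velocity M \<gamma> s) (velocity M \<gamma> s)"
      using s c(1) velocity_eq_coord_vec[of \<gamma> s c] by (simp add: chart_metric_def chart_inv_left)
  qed (use t c in auto)
qed

text \<open>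
  The speed has derivative zero on \<open>{0..1}\<close>, so the length is the integral of its initial value.
\<close>

lemma geodesic_length:
  assumes J: "open J" "{0..1} \<subseteq> J" and geo: "geodesic_on M J \<gamma>"
  shows "curve_length M \<gamma> = tnorm M (\<gamma> 0) (velocity M \<gamma> 0)"
proof -
  let ?f = "\<lambda>s. metric M (\<gamma> s) (velocity M \<gamma> s) (velocity M \<gamma> s)"
  have der: "(?f has_real_derivative 0) (at t)" if "t \<in> {0..1}" for t
    using geodesic_speed_derivative[OF J(1) geo] J(2) that by blast
  have "continuous_on {0..1} ?f"
    by (intro continuous_at_imp_continuous_on ballI) (rule DERIV_isCont[OF der])
  then have speed: "?f t = ?f 0" if "t \<in> {0..1}" for t
    using DERIV_isconst2[of 0 1 ?f t] der that by simp
  have const: "tnorm M (\<gamma> t) (velocity M \<gamma> t) = tnorm M (\<gamma> 0) (velocity M \<gamma> 0)" if "t \<in> {0..1}" for t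
    unfolding tnorm_def by (rule arg_cong[of _ _ sqrt]) (rule speed[OF that])
  have "curve_length M \<gamma> = integral {0..1::real} (\<lambda>_. tnorm M (\<gamma> 0) (velocity M \<gamma> 0))"
    unfolding curve_length_def by (rule integral_cong) (rule const)
  then show ?thesis by simp
qed

end

section \<open>Reversing curves\<close>

lemma open_reflection: "open S \<Longrightarrow> open ((\<lambda>t::real. 1 - t) -` S)"
  by (intro continuous_open_vimage continuous_intros)

lemma Ck_on_reflection:
  fixes f :: "real \<Rightarrow> 'b::real_normed_vector"
  assumes "Ck_on k S f" "open S"
  shows "Ck_on k ((\<lambda>t. 1 - t) -` S) (f \<circ> (\<lambda>t. 1 - t))"
  using assms
proof (induction k arbitrary: f)
  case 0
  then have "continuous_on S f" by simp
  then have "continuous_on ((\<lambda>t. 1 - t) -` S) (f \<circ> (\<lambda>t. 1 - t))"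
    by (intro continuous_on_compose continuous_intros) (auto elim: continuous_on_subset)
  then show ?case by simp
next
  case (Suc k)
  have der: "(f \<circ> (\<lambda>t. 1 - t) has_derivative (\<lambda>v. frechet_derivative f (at (1 - t)) (- v))) (at t)"
    if "1 - t \<in> S" for t
  proof -
    have "((\<lambda>t::real. 1 - t) has_derivative (\<lambda>v. - v)) (at t)"
      by (auto intro!: derivative_eq_intros)
    moreover have "(f has_derivative frechet_derivative f (at (1 - t))) (at (1 - t))"
      using Suc.prems(1) that by (simp add: frechet_derivative_works)
    ultimately have "(f \<circ> (\<lambda>t. 1 - t) has_derivative frechet_derivative f (at (1 - t)) \<circ> (\<lambda>v. - v)) (at t)"
      by (rule diff_chain_at)
    then show ?thesis unfolding o_def .
  qed
  have "Ck_on k ((\<lambda>t. 1 - t) -` S) (\<lambda>t. frechet_derivative (f \<circ> (\<lambda>t. 1 - t)) (at t) v)" for v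
  proof (rule Ck_on_cong)
    have "Ck_on k S (\<lambda>x. frechet_derivative f (at x) (- v))" using Suc.prems(1) by simp
    then show "Ck_on k ((\<lambda>t. 1 - t) -` S) ((\<lambda>x. frechet_derivative f (at x) (- v)) \<circ> (\<lambda>t. 1 - t))"
      using Suc.prems(2) by (rule Suc.IH)
    show "open ((\<lambda>t::real. 1 - t) -` S)" by (rule open_reflection[OF Suc.prems(2)])
    fix t assume "t \<in> (\<lambda>t. 1 - t) -` S"
    then have "1 - t \<in> S" by simp
    from frechet_derivative_at[OF der[OF this]]
    show "((\<lambda>x. frechet_derivative f (at x) (- v)) \<circ> (\<lambda>t. 1 - t)) t = frechet_derivative (f \<circ> (\<lambda>t. 1 - t)) (at t) v"
      by (metis comp_apply)
  qed
  moreover have "f \<circ> (\<lambda>t. 1 - t) differentiable at t" if "t \<in> (\<lambda>t. 1 - t) -` S" for t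
    using der[of t] that by (auto simp: differentiable_def)
  ultimately show ?case by (simp add: o_def)
qed

lemma smooth_on_reflection:
  fixes f :: "real \<Rightarrow> 'b::real_normed_vector"
  assumes "smooth_on S f" "open S"
  shows "smooth_on ((\<lambda>t. 1 - t) -` S) (f \<circ> (\<lambda>t. 1 - t))"
  using assms by (auto simp: smooth_on_def intro: Ck_on_reflection)

text \<open>
  The identity holds also for functions that are not integrable, so the length of a curve can be
  reflected with no discussion of integrability.
\<close>

lemma integral_reflection: "integral {0..1} (\<lambda>t. f (1 - t)) = integral {0..1::real} (f :: real \<Rightarrow> real)"
proof -
  have "integral {0..1} f = integral {-1..0} (\<lambda>t. f (- t))"
    using Henstock_Kurzweil_Integration.integral_reflect_real[of 1 0 f] by simp
  also have "\<dots> = integral {0..1} (\<lambda>t. f (- (t - 1)))"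
    using integral_shift_real_ivl[of "-1" "-1" 0 "\<lambda>t. f (- t)"] by simp
  finally show ?thesis by (simp add: minus_diff_eq)
qed

lemma finite_set_gap:
  assumes "finite (S :: real set)" "{0, 1} \<subseteq> S" "t \<in> {0..1}" "t \<notin> S"
  obtains a b where "a \<in> S" "b \<in> S" "a < t" "t < b" "{a<..<b} \<inter> S = {}"
proof
  let ?A = "{s \<in> S. s < t}" and ?B = "{s \<in> S. t < s}"
  have "t \<noteq> 0" "t \<noteq> 1" using assms by auto
  then have ne: "0 \<in> ?A" "1 \<in> ?B" using assms by auto
  have fin: "finite ?A" "finite ?B" using assms(1) by auto
  have A: "Max ?A \<in> ?A" using Max_in[OF fin(1)] ne by blast
  have B: "Min ?B \<in> ?B" using Min_in[OF fin(2)] ne by blast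
  show "Max ?A \<in> S" "Max ?A < t" using A by auto
  show "Min ?B \<in> S" "t < Min ?B" using B by auto
  show "{Max ?A<..<Min ?B} \<inter> S = {}"
  proof (rule ccontr)
    assume "{Max ?A<..<Min ?B} \<inter> S \<noteq> {}"
    then obtain s where s: "Max ?A < s" "s < Min ?B" "s \<in> S" by auto
    have "s \<noteq> t" using s assms by auto
    then have "s \<in> ?A \<or> s \<in> ?B" using s(3) by auto
    then show False using Max_ge[OF fin(1), of s] Min_le[OF fin(2), of s] s by auto
  qed
qed

context riemannian_manifold
begin

lemma smooth_curve_reflection:
  assumes "smooth_curve_on M J \<gamma>" "open J"
  shows "smooth_curve_on M ((\<lambda>t. 1 - t) -` J) (\<gamma> \<circ> (\<lambda>t. 1 - t))"
  unfolding smooth_curve_on_def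
proof (intro conjI ballI)
  have cont: "continuous_on J \<gamma>" using assms(1) by (simp add: smooth_curve_on_def)
  then show "continuous_on ((\<lambda>t. 1 - t) -` J) (\<gamma> \<circ> (\<lambda>t. 1 - t))"
    by (intro continuous_on_compose continuous_intros) (auto elim: continuous_on_subset)
  fix c assume c: "c \<in> atlas M"
  have "smooth_on {t \<in> J. \<gamma> t \<in> fst c} (snd c \<circ> \<gamma>)"
    using assms(1) c by (simp add: smooth_curve_on_def)
  from smooth_on_reflection[OF this open_chart_times[OF cont assms(2) c]]
  have smooth: "smooth_on ((\<lambda>t. 1 - t) -` {t \<in> J. \<gamma> t \<in> fst c}) (snd c \<circ> (\<gamma> \<circ> (\<lambda>t. 1 - t)))"
    by (simp only: comp_assoc)
  have times: "(\<lambda>t. 1 - t) -` {t \<in> J. \<gamma> t \<in> fst c} =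
      {t \<in> (\<lambda>t. 1 - t) -` J. (\<gamma> \<circ> (\<lambda>t. 1 - t)) t \<in> fst c}" by auto
  show "smooth_on {t \<in> (\<lambda>t. 1 - t) -` J. (\<gamma> \<circ> (\<lambda>t. 1 - t)) t \<in> fst c}
      (snd c \<circ> (\<gamma> \<circ> (\<lambda>t. 1 - t)))" using smooth unfolding times .
qed

lemma piecewise_smooth_curve_reflection:
  assumes "piecewise_smooth_curve M \<gamma>"
  shows "piecewise_smooth_curve M (\<gamma> \<circ> (\<lambda>t. 1 - t))"
proof -
  let ?R = "\<lambda>t::real. 1 - t"
  obtain S where S: "finite S" "{0, 1} \<subseteq> S" "S \<subseteq> {0..1}"
    and pieces: "\<forall>a\<in>S. \<forall>b\<in>S. a < b \<and> {a<..<b} \<inter> S = {} \<longrightarrow>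
      (\<exists>J \<eta>. open J \<and> {a..b} \<subseteq> J \<and> smooth_curve_on M J \<eta> \<and> (\<forall>t\<in>{a..b}. \<eta> t = \<gamma> t))"
    using assms unfolding piecewise_smooth_curve_def by (elim conjE exE)
  have pieces': "\<exists>J \<eta>. open J \<and> {a..b} \<subseteq> J \<and> smooth_curve_on M J \<eta> \<and> (\<forall>t\<in>{a..b}. \<eta> t = (\<gamma> \<circ> ?R) t)"
    if a: "a \<in> ?R ` S" and b: "b \<in> ?R ` S" and ab: "a < b \<and> {a<..<b} \<inter> ?R ` S = {}" for a b
  proof -
    have "{1 - b<..<1 - a} \<inter> S = {}"
    proof (rule ccontr)
      assume "{1 - b<..<1 - a} \<inter> S \<noteq> {}"
      then obtain s where "s \<in> S" "1 - b < s" "s < 1 - a" by auto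
      then have "1 - s \<in> {a<..<b} \<inter> ?R ` S" by auto
      then show False using ab by blast
    qed
    moreover have "1 - b \<in> S" "1 - a \<in> S" "1 - b < 1 - a" using a b ab by auto
    ultimately obtain J \<eta> where J: "open J" "{1 - b..1 - a} \<subseteq> J" "smooth_curve_on M J \<eta>"
        "\<forall>t\<in>{1 - b..1 - a}. \<eta> t = \<gamma> t"
      using pieces[rule_format, of "1 - b" "1 - a"] by blast
    show ?thesis
    proof (intro exI conjI ballI)
      show "open (?R -` J)" by (rule open_reflection[OF J(1)])
      show "{a..b} \<subseteq> ?R -` J"
      proof
        fix t assume "t \<in> {a..b}"
        then have "1 - t \<in> {1 - b..1 - a}" by auto
        then show "t \<in> ?R -` J" using J(2) by blast
      qed
      show "smooth_curve_on M (?R -` J) (\<eta> \<circ> ?R)" by (rule smooth_curve_reflection[OF J(3,1)])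
      fix t assume "t \<in> {a..b}"
      then show "(\<eta> \<circ> ?R) t = (\<gamma> \<circ> ?R) t" using J(4) by auto
    qed
  qed
  show ?thesis
    unfolding piecewise_smooth_curve_def
  proof (rule conjI, goal_cases)
    case 1
    have "continuous_on {0..1} \<gamma>" using assms by (simp add: piecewise_smooth_curve_def)
    then show ?case
      by (intro continuous_on_compose continuous_intros) (auto elim: continuous_on_subset)
  next
    case 2
    show ?case
    proof (rule exI[of _ "?R ` S"], intro conjI ballI impI)
      show "finite (?R ` S)" "{0, 1} \<subseteq> ?R ` S" "?R ` S \<subseteq> {0..1}" using S by force+
    qed (rule pieces')
  qed
qed

lemma velocity_reflection:
  assumes "curve_differentiable_at \<gamma> (1 - t)"
  shows "velocity M (\<gamma> \<circ> (\<lambda>t. 1 - t)) t = (\<lambda>c. - velocity M \<gamma> (1 - t) c)"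
proof
  fix c
  show "velocity M (\<gamma> \<circ> (\<lambda>t. 1 - t)) t c = - velocity M \<gamma> (1 - t) c"
  proof (cases "c \<in> atlas M \<and> \<gamma> (1 - t) \<in> fst c")
    case True
    then have "((snd c \<circ> \<gamma>) has_vector_derivative vector_derivative (snd c \<circ> \<gamma>) (at (1 - t))) (at (1 - t))"
      using assms by (simp add: curve_differentiable_at_def vector_derivative_works)
    moreover have "((\<lambda>t::real. 1 - t) has_vector_derivative - 1) (at t)"
      by (auto intro!: derivative_eq_intros)
    ultimately have "((snd c \<circ> \<gamma>) \<circ> (\<lambda>t. 1 - t) has_vector_derivative
        (- 1) *\<^sub>R vector_derivative (snd c \<circ> \<gamma>) (at (1 - t))) (at t)"
      by (intro vector_diff_chain_at)
    then have "vector_derivative (snd c \<circ> (\<gamma> \<circ> (\<lambda>t. 1 - t))) (at t) = - vector_derivative (snd c \<circ> \<gamma>) (at (1 - t))"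
      by (simp add: vector_derivative_at comp_assoc)
    then show ?thesis using True by (simp add: velocity_def)
  next
    case False
    then show ?thesis by (auto simp: velocity_def)
  qed
qed

lemma tangent_vector_eq_coord_vec:
  assumes X: "X \<in> tangent_space M p" and c: "c \<in> atlas M" "p \<in> fst c"
  shows "X = coord_vec M c p (X c)"
proof
  fix c'
  have zero: "c' \<notin> atlas M \<or> p \<notin> fst c' \<Longrightarrow> X c' = 0"
    and trans: "c' \<in> atlas M \<Longrightarrow> p \<in> fst c' \<Longrightarrow> X c' = frechet_derivative (transition c c') (at (snd c p)) (X c)"
    using X c unfolding tangent_space_def by blast+
  show "X c' = coord_vec M c p (X c) c'"
  proof (cases "c' \<in> atlas M \<and> p \<in> fst c'")
    case True
    then show ?thesis unfolding coord_vec_def using trans by presburger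
  next
    case False
    then show ?thesis unfolding coord_vec_def using zero by presburger
  qed
qed

lemma metric_uminus:
  assumes "X \<in> tangent_space M p"
  shows "metric M p (\<lambda>c. - X c) (\<lambda>c. - X c) = metric M p X X"
proof -
  obtain c where c: "c \<in> atlas M" "p \<in> fst c" by (rule chart_at)
  have "(\<lambda>c. - X c) = coord_vec M c p ((- 1) *\<^sub>R X c + 0 *\<^sub>R X c)"
    unfolding coord_vec_combination[OF c] tangent_vector_eq_coord_vec[OF assms c, symmetric] by simp
  then have neg: "(\<lambda>c. - X c) \<in> tangent_space M p"
    using coord_vec_tangent[OF c] by metis
  have flip: "metric M p (\<lambda>c. - X c) Z = - metric M p X Z" if "Z \<in> tangent_space M p" for Z
    using metric_linear[OF assms assms that, of "-1" 0] by simp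
  show ?thesis
    using flip[OF neg] flip[OF assms] metric_sym[OF assms neg] by simp
qed

text \<open>
  Away from the finitely many break points the curve is differentiable, and there reversal only changes
  the sign of the velocity, which leaves the norm unchanged.  At the break points the velocities carry
  no information, but these form a negligible set.
\<close>

lemma curve_length_reflection:
  assumes "piecewise_smooth_curve M \<gamma>"
  shows "curve_length M (\<gamma> \<circ> (\<lambda>t. 1 - t)) = curve_length M \<gamma>"
proof -
  obtain S where S: "finite S" "{0, 1} \<subseteq> S" "S \<subseteq> {0..1}"
    and pieces: "\<forall>a\<in>S. \<forall>b\<in>S. a < b \<and> {a<..<b} \<inter> S = {} \<longrightarrow>
      (\<exists>J \<eta>. open J \<and> {a..b} \<subseteq> J \<and> smooth_curve_on M J \<eta> \<and> (\<forall>t\<in>{a..b}. \<eta> t = \<gamma> t))"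
    using assms unfolding piecewise_smooth_curve_def by (elim conjE exE)
  \<comment> \<open>between two consecutive break points the curve agrees with a smooth one\<close>
  have diff: "curve_differentiable_at \<gamma> t" if t: "t \<in> {0..1}" "t \<notin> S" for t
  proof -
    obtain a b where ab: "a \<in> S" "b \<in> S" "a < t" "t < b" "{a<..<b} \<inter> S = {}"
      using finite_set_gap[OF S(1,2) t] .
    then obtain J \<eta> where J: "open J" "{a..b} \<subseteq> J" "smooth_curve_on M J \<eta>" "\<forall>t\<in>{a..b}. \<eta> t = \<gamma> t"
      using pieces[rule_format, OF ab(1,2)] by auto
    have "curve_differentiable_at \<eta> t"
      using J(2) ab by (intro smooth_curve_differentiable_at[OF J(3,1)]) auto
    then show ?thesis
      by (rule curve_differentiable_at_cong[of "{a<..<b}", rotated 3]) (use ab J(4) in auto)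
  qed
  let ?f = "\<lambda>t. tnorm M (\<gamma> t) (velocity M \<gamma> t)"
  have "integral {0..1} (\<lambda>t. tnorm M ((\<gamma> \<circ> (\<lambda>t. 1 - t)) t) (velocity M (\<gamma> \<circ> (\<lambda>t. 1 - t)) t)) =
      integral {0..1} (\<lambda>t. ?f (1 - t))"
  proof (rule integral_spike[of "(\<lambda>t. 1 - t) ` S"])
    show "negligible ((\<lambda>t. 1 - t) ` S)" using S(1) by (simp add: negligible_finite)
    fix t :: real assume t: "t \<in> {0..1} - (\<lambda>t. 1 - t) ` S"
    have "1 - t \<notin> S"
    proof
      assume "1 - t \<in> S"
      then have "1 - (1 - t) \<in> (\<lambda>t. 1 - t) ` S" by (rule imageI)
      then show False using t by simp
    qed
    then have d: "curve_differentiable_at \<gamma> (1 - t)" using t by (intro diff) auto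
    show "?f (1 - t) = tnorm M ((\<gamma> \<circ> (\<lambda>t. 1 - t)) t) (velocity M (\<gamma> \<circ> (\<lambda>t. 1 - t)) t)"
      unfolding velocity_reflection[OF d] tnorm_def by (simp add: metric_uminus[OF velocity_tangent[OF d]])
  qed
  then show ?thesis unfolding curve_length_def using integral_reflection[of ?f] by (rule trans)
qed

text \<open>
  Reversal shows that the two infima are taken over the same set of lengths.
\<close>

lemma rdist_commute: "rdist M p q = rdist M q p"
proof -
  have sub: "{curve_length M \<gamma> |\<gamma>. piecewise_smooth_curve M \<gamma> \<and> \<gamma> 0 = p \<and> \<gamma> 1 = q}
      \<subseteq> {curve_length M \<gamma> |\<gamma>. piecewise_smooth_curve M \<gamma> \<and> \<gamma> 0 = q \<and> \<gamma> 1 = p}" for p q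
  proof clarify
    fix \<gamma> assume \<gamma>: "piecewise_smooth_curve M \<gamma>"
    show "\<exists>\<eta>. curve_length M \<gamma> = curve_length M \<eta> \<and> piecewise_smooth_curve M \<eta> \<and> \<eta> 0 = \<gamma> 1 \<and> \<eta> 1 = \<gamma> 0"
      by (rule exI[of _ "\<gamma> \<circ> (\<lambda>t. 1 - t)"])
         (simp add: curve_length_reflection[OF \<gamma>] piecewise_smooth_curve_reflection[OF \<gamma>])
  qed
  show ?thesis unfolding rdist_def using sub[of p q] sub[of q p] by (intro arg_cong[of _ _ Inf] equalityI)
qed

section \<open>The logarithm and the Fenchel inequality\<close>

text \<open>
  The preimage of \<open>p\<close> is the initial velocity of the shortest geodesic from \<open>m\<close> to \<open>p\<close>.
\<close>

lemma exp_map_surj_on_log_domain: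
  assumes C: "strongly_convex M C" "m \<in> C" "p \<in> C"
  shows "p \<in> exp_map M m ` log_domain M C m"
proof -
  obtain \<gamma> where \<gamma>: "geodesic_between M m p \<gamma>" and len: "curve_length M \<gamma> = rdist M m p"
    using C unfolding strongly_convex_def shortest_geodesic_def by blast
  obtain J where J: "open J" "{0..1} \<subseteq> J" "geodesic_on M J \<gamma>" and ends: "\<gamma> 0 = m" "\<gamma> 1 = p"
    using \<gamma> unfolding geodesic_between_def by blast
  let ?X = "velocity M \<gamma> 0"
  have exp: "exp_map M m ?X = p" by (rule exp_map_velocity[OF \<gamma>])
  have "0 \<in> J" using J(2) by auto
  from velocity_tangent[OF geodesic_curve_differentiable_at[OF J(3,1) this]]
  have "?X \<in> exp_domain M m" using \<gamma> ends unfolding exp_domain_def by blast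
  moreover have "tnorm M m ?X = rdist M p m"
    using geodesic_length[OF J] len ends rdist_commute[of m p] by simp
  ultimately have "?X \<in> log_domain M C m" using C(3) by (simp add: log_domain_def exp)
  then show ?thesis using exp by (metis imageI)
qed

end

text \<open>
  For finite \<open>a\<close> this is cancellation.  If \<open>a = \<infinity>\<close>, the right-hand side is \<open>\<infinity>\<close> for every \<open>b\<close>,
  even \<open>-\<infinity>\<close>, by the convention for sums of extended reals.
\<close>

lemma ereal_le_add_of_diff_le:
  fixes a b :: ereal
  assumes "ereal r - a \<le> b" "a \<noteq> -\<infinity>"
  shows "ereal r \<le> a + b"
  using assms by (cases a; cases b) auto

theorem proposition3p9:
  fixes M :: "('m::{t2_space, second_countable_topology}, 'e::real_inner) riemannian_structure"
    and C :: "'m set" and F :: "'m \<Rightarrow> ereal" and m :: 'm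
  assumes "riemannian_manifold M"
    and "strongly_convex M C"
    and "proper_on C F"
    and "m \<in> C"
  shows "\<forall>p\<in>C. \<forall>\<xi>\<in>cotangent_space M m.
           F p + fenchel_conjugate M C m F \<xi> \<ge> ereal (\<xi> (log_map M C m p))"
proof (intro ballI)
  interpret riemannian_manifold M by (rule assms(1))
  fix p \<xi> assume p: "p \<in> C"
  let ?X = "log_map M C m p"
  have surj: "p \<in> exp_map M m ` log_domain M C m"
    by (rule exp_map_surj_on_log_domain[OF assms(2,4) p])
  have X: "?X \<in> log_domain M C m" "exp_map M m ?X = p"
    unfolding log_map_def by (rule inv_into_into[OF surj], rule f_inv_into_f[OF surj])
  have "ereal (\<xi> ?X) - F (exp_map M m ?X) \<le> fenchel_conjugate M C m F \<xi>"
    unfolding fenchel_conjugate_def by (rule SUP_upper[OF X(1)])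
  moreover have "F p \<noteq> -\<infinity>" using assms(3) p by (simp add: proper_on_def)
  ultimately show "ereal (\<xi> ?X) \<le> F p + fenchel_conjugate M C m F \<xi>"
    unfolding X(2) by (rule ereal_le_add_of_diff_le)
qed

end
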